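(* (a) Let $\mathcal{H}$ be a Hilbert space, $T:\mathcal{H}\to\mathcal{H}$ a Hilbert-Schmidt operator, and let $$TT^{*}=\sum_j\lambda_j^{2}\,|\phi_j\rangle\langle\phi_j|$$ (spectral representation) with $\lambda_1^{2}\ge\lambda_2^{2}\ge\cdots$, and $\lambda_j\to0$ as $j\to\infty$. Then $$\sum_{j=1}^{n}|\phi_j\rangle\langle\phi_j|=\operatorname{argmax}\left\{\|Q_nT\|_{HS}^{2}\;:\;\|Q_n\|_{HS}^{2}=n,\ Q_n=Q_n^{*}=Q_n^{2}\right\}.$$ Note that $\|Q_nT\|_{HS}^{2}=\operatorname{tr}(Q_nG)$, where $G:=TT^{*}$. (b) The assumption that $T$ is Hilbert-Schmidt is equivalent to $T^{*}T$ being trace class. Applying the Spectral Theorem to $T^{*}T$ then yields an orthonormal basis of eigenvectors for $T^{*}T$, and a convergent representation for the infinite sum $\sum_j\lambda_j^{2}|\phi_j\rangle\langle\phi_j|$ in (a).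
   Context: Inner products are conjugate linear in the first variable; $|u\rangle\langle v|$ denotes the rank-one operator $w\mapsto\langle v,w\rangle u$. The $\phi_j$ are the orthonormal eigenvectors in the spectral representation of $TT^{*}$. $\|A\|_{HS}^{2}=\operatorname{tr}(A^{*}A)$ is the squared Hilbert-Schmidt norm. $Q_n$ ranges over operators on $\mathcal{H}$, and $n\in\mathbb{N}$. The notation argmax stands for the data which realizes the optimization (here, the maximum). *)

theory Defs
  imports "HOL-Analysis.Analysis"
begin

text \<open>
  A complex inner product space is presented as a real one (inner product \<open>x \<bullet> y = Re \<langle>x, y\<rangle>\<close>) with a
  compatible complex structure, so that norm, convergence, \<open>bounded_linear\<close> and \<open>onorm\<close> are those
  of the library. The complex inner product is conjugate linear in its first argument.
\<close>

class complex_inner = real_inner +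
  fixes scaleC :: "complex \<Rightarrow> 'a \<Rightarrow> 'a"  (infixr "*\<^sub>C" 75)
    and cinner :: "'a \<Rightarrow> 'a \<Rightarrow> complex"
  assumes scaleC_add_right: "a *\<^sub>C (x + y) = a *\<^sub>C x + a *\<^sub>C y"
    and scaleC_add_left: "(a + b) *\<^sub>C x = a *\<^sub>C x + b *\<^sub>C x"
    and scaleC_scaleC: "a *\<^sub>C (b *\<^sub>C x) = (a * b) *\<^sub>C x"
    and scaleC_of_real: "complex_of_real r *\<^sub>C x = r *\<^sub>R x"
    and cinner_commute: "cinner x y = cnj (cinner y x)"
    and cinner_add_right: "cinner x (y + z) = cinner x y + cinner x z"
    and cinner_scaleC_right: "cinner x (a *\<^sub>C y) = a * cinner x y"
    and Re_cinner: "Re (cinner x y) = inner x y"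

lemma cinner_self: "cinner x x = complex_of_real ((norm x)\<^sup>2)"
proof (rule complex_eqI)
  show "Re (cinner x x) = Re (complex_of_real ((norm x)\<^sup>2))"
    by (simp add: Re_cinner power2_norm_eq_inner)
  have "Im (cinner x x) = Im (cnj (cinner x x))"
    by (rule arg_cong[OF cinner_commute])
  then show "Im (cinner x x) = Im (complex_of_real ((norm x)\<^sup>2))"
    by simp
qed

class chilbert_space = complex_inner + complete_space

instantiation complex :: chilbert_space
begin

definition scaleC_complex :: "complex \<Rightarrow> complex \<Rightarrow> complex"
  where "scaleC_complex a x = a * x"

definition cinner_complex :: "complex \<Rightarrow> complex \<Rightarrow> complex"
  where "cinner_complex x y = cnj x * y"

instance
  by standard
    (simp_all add: scaleC_complex_def cinner_complex_def algebra_simps scaleR_conv_of_real inner_complex_def)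

end

definition bounded_clinear :: "('a::complex_inner \<Rightarrow> 'a) \<Rightarrow> bool"
  where "bounded_clinear A \<longleftrightarrow> bounded_linear A \<and> (\<forall>c x. A (c *\<^sub>C x) = c *\<^sub>C A x)"

definition adj :: "('a::complex_inner \<Rightarrow> 'a) \<Rightarrow> 'a \<Rightarrow> 'a"
  where "adj A = (THE B. \<forall>x y. cinner (B x) y = cinner x (A y))"

definition rank_one :: "'a::complex_inner \<Rightarrow> 'a \<Rightarrow> 'a \<Rightarrow> 'a"
  where "rank_one u v = (\<lambda>w. cinner v w *\<^sub>C u)"

definition orthonormal_family :: "('i \<Rightarrow> 'a::complex_inner) \<Rightarrow> 'i set \<Rightarrow> bool"
  where "orthonormal_family \<phi> J \<longleftrightarrow>
    (\<forall>i\<in>J. \<forall>j\<in>J. cinner (\<phi> i) (\<phi> j) = (if i = j then 1 else 0))"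

text \<open>The space need not be separable, so an orthonormal basis is an arbitrary set.\<close>

definition is_onb :: "'a::complex_inner set \<Rightarrow> bool"
  where "is_onb B \<longleftrightarrow> orthonormal_family (\<lambda>e. e) B \<and> closure (module.span scaleC B) = UNIV"

definition positive_op :: "('a::complex_inner \<Rightarrow> 'a) \<Rightarrow> bool"
  where "positive_op A \<longleftrightarrow> bounded_clinear A \<and> (\<forall>x. cinner x (A x) \<in> \<real>\<^sub>\<ge>\<^sub>0)"

text \<open>\<open>|A| = (A\<^sup>* A)\<^sup>1\<^sup>/\<^sup>2\<close>, the unique positive square root.\<close>

definition abs_op :: "('a::complex_inner \<Rightarrow> 'a) \<Rightarrow> 'a \<Rightarrow> 'a"
  where "abs_op A = (THE P. positive_op P \<and> P \<circ> P = adj A \<circ> A)"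

definition trace_class :: "('a::complex_inner \<Rightarrow> 'a) \<Rightarrow> bool"
  where "trace_class A \<longleftrightarrow> bounded_clinear A \<and>
    (\<exists>B. is_onb B \<and> (\<lambda>e. cinner e (abs_op A e)) summable_on B)"

text \<open>
  The trace is the common value of \<open>\<Sum>e\<in>B. \<langle>e, A e\<rangle>\<close> over all orthonormal bases \<open>B\<close>. It is only
  meaningful when these series converge; in particular it does not default to \<open>0\<close>.
\<close>

definition op_trace :: "('a::complex_inner \<Rightarrow> 'a) \<Rightarrow> complex"
  where "op_trace A = (THE t. \<forall>B. is_onb B \<longrightarrow> ((\<lambda>e. cinner e (A e)) has_sum t) B)"

definition hilbert_schmidt :: "('a::complex_inner \<Rightarrow> 'a) \<Rightarrow> bool"
  where "hilbert_schmidt A \<longleftrightarrow> bounded_clinear A \<and>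
    (\<exists>B. is_onb B \<and> (\<lambda>e. (norm (A e))\<^sup>2) summable_on B)"

definition hs_norm :: "('a::complex_inner \<Rightarrow> 'a) \<Rightarrow> real"
  where "hs_norm A = sqrt (Re (op_trace (adj A \<circ> A)))"

text \<open>
  \<open>G = \<Sum>j. \<sigma>\<^sub>j\<^sup>2 |\<phi>\<^sub>j\<rangle>\<langle>\<phi>\<^sub>j|\<close> with \<open>\<sigma>\<^sub>1\<^sup>2 \<ge> \<sigma>\<^sub>2\<^sup>2 \<ge> \<dots>\<close>. The family is indexed by \<open>1, 2, \<dots>\<close> and is finite or
  infinite (it must be finite if the space is finite-dimensional); the \<open>\<phi>\<^sub>j\<close> need not span, and
  \<open>\<sigma>\<^sub>j = 0\<close> is allowed. The series is required to converge pointwise.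
\<close>

definition spectral_rep ::
    "('a::complex_inner \<Rightarrow> 'a) \<Rightarrow> nat set \<Rightarrow> (nat \<Rightarrow> real) \<Rightarrow> (nat \<Rightarrow> 'a) \<Rightarrow> bool"
  where "spectral_rep G J \<sigma> \<phi> \<longleftrightarrow>
    (J = {1..} \<or> (\<exists>N. J = {1..N})) \<and>
    orthonormal_family \<phi> J \<and>
    (\<forall>i\<in>J. \<forall>j\<in>J. i \<le> j \<longrightarrow> (\<sigma> j)\<^sup>2 \<le> (\<sigma> i)\<^sup>2) \<and>
    (J = {1..} \<longrightarrow> \<sigma> \<longlonglongrightarrow> 0) \<and>
    (\<forall>x. ((\<lambda>j. (\<sigma> j)\<^sup>2 *\<^sub>R rank_one (\<phi> j) (\<phi> j) x) has_sum G x) J)"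

text \<open>The feasible operators \<open>Q\<close>: \<open>\<parallel>Q\<parallel>\<^sub>H\<^sub>S\<^sup>2 = n\<close> and \<open>Q = Q\<^sup>* = Q\<^sup>2\<close>.\<close>

definition hs_projection :: "nat \<Rightarrow> ('a::complex_inner \<Rightarrow> 'a) \<Rightarrow> bool"
  where "hs_projection n Q \<longleftrightarrow>
    hilbert_schmidt Q \<and> (hs_norm Q)\<^sup>2 = real n \<and> Q = adj Q \<and> Q = Q \<circ> Q"

end

theory Submission
  imports Defs
begin

text \<open>
  The value of \<open>\<parallel>Q T\<parallel>\<^sub>H\<^sub>S\<^sup>2 = tr (Q G)\<close> for a projection \<open>Q\<close> of rank \<open>n\<close> can be read off in an orthonormal basis
  that extends the eigenvectors \<open>\<phi>\<^sub>j\<close> of \<open>G = T T\<^sup>*\<close>: it is \<open>\<Sum>\<^sub>j \<sigma>\<^sub>j\<^sup>2 a\<^sub>j\<close> with \<open>a\<^sub>j = \<parallel>Q \<phi>\<^sub>j\<parallel>\<^sup>2\<close>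
  (\<open>hs_norm_compose_spectral\<close>). The weights satisfy \<open>0 \<le> a\<^sub>j \<le> 1\<close> and \<open>\<Sum>\<^sub>j a\<^sub>j \<le> n\<close>, so this is at most the
  sum of the \<open>n\<close> largest \<open>\<sigma>\<^sub>j\<^sup>2\<close> (\<open>weighted_sum_le\<close>), which is the value at the projection onto
  \<open>\<phi>\<^sub>1, \<dots>, \<phi>\<^sub>n\<close>. If \<open>\<sigma>\<^sub>n \<noteq> 0\<close> and there is a gap after \<open>\<sigma>\<^sub>n\<^sup>2\<close>, equality forces \<open>a\<^sub>j = 1\<close> for \<open>j \<le> n\<close>; then
  \<open>Q\<close> fixes \<open>\<phi>\<^sub>1, \<dots>, \<phi>\<^sub>n\<close>, and these already account for its trace (\<open>hs_projection_eq_orth_proj\<close>).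
  The trace formula itself is a change of the order of summation in a double series
  (\<open>hilbert_schmidt_cinner_has_sum_adj\<close>).

  For (b), \<open>T\<^sup>* T\<close> is positive, so it is its own absolute value as soon as positive square roots are unique.
  This is shown by an argument with approximate eigenvectors that does without a functional
  calculus (\<open>positive_op_square_root_unique\<close>). Then both conditions say that \<open>\<Sum>\<parallel>T e\<parallel>\<^sup>2\<close> converges.
  The spectral representation of \<open>A\<^sup>* A\<close> for a Hilbert-Schmidt operator \<open>A\<close> is built greedily: by
  compactness, \<open>\<parallel>A x\<parallel>\<close> attains its maximum over the unit vectors orthogonal to the eigenvectors found so far,
  and a maximizer is the next eigenvector (\<open>maximal_eigenvector\<close>). The operators \<open>T\<close> and \<open>T\<^sup>*\<close> in place of
  \<open>A\<close> give the eigenbasis for \<open>T\<^sup>* T\<close> and the norm convergent series for \<open>T T\<^sup>*\<close>.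

  The Hilbert space theory underneath (Riesz representation, adjoints, change of basis) rests on orthonormal
  expansions alone: every orthonormal set extends to a maximal one by Zorn's lemma, and square summable
  coefficients define convergent series by completeness (\<open>orthonormal_series_summable\<close>).
\<close>

section \<open>Complex inner products\<close>

instance chilbert_space \<subseteq> banach ..

interpretation cmod: module "scaleC :: complex \<Rightarrow> 'a::complex_inner \<Rightarrow> 'a"
proof
  fix x :: 'a
  show "1 *\<^sub>C x = x"
    using scaleC_of_real[of 1 x] by simp
qed (simp_all add: scaleC_add_right scaleC_add_left scaleC_scaleC)

lemma scaleC_scaleR_commute: "c *\<^sub>C (r *\<^sub>R (x::'a::complex_inner)) = r *\<^sub>R (c *\<^sub>C x)"
  by (metis scaleC_of_real scaleC_scaleC mult.commute)

lemma cinner_add_left: "cinner (x + y) z = cinner x z + cinner y z"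
  by (metis cinner_add_right cinner_commute complex_cnj_add)

lemma cinner_scaleC_left: "cinner (a *\<^sub>C x) y = cnj a * cinner x y"
  by (metis cinner_scaleC_right cinner_commute complex_cnj_mult)

lemma additive_cinner_right: "Modules.additive (cinner x)"
  by standard (rule cinner_add_right)

lemma additive_cinner_left: "Modules.additive (\<lambda>x. cinner x y)"
  by standard (rule cinner_add_left)

lemmas cinner_zero_right [simp] = Modules.additive.zero[OF additive_cinner_right]
lemmas cinner_zero_left [simp] = Modules.additive.zero[OF additive_cinner_left]
lemmas cinner_diff_right = Modules.additive.diff[OF additive_cinner_right]
lemmas cinner_diff_left = Modules.additive.diff[OF additive_cinner_left]

lemmas cinner_sum_right = Modules.additive.sum[OF additive_cinner_right]
lemmas cinner_sum_left = Modules.additive.sum[OF additive_cinner_left]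

lemma cinner_scaleR_right: "cinner x (r *\<^sub>R y) = r *\<^sub>R cinner x y"
  by (metis cinner_scaleC_right scaleC_of_real scaleR_conv_of_real)

lemma cinner_scaleR_left: "cinner (r *\<^sub>R x) y = r *\<^sub>R cinner x y"
  by (metis cinner_scaleC_left scaleC_of_real scaleR_conv_of_real complex_cnj_complex_of_real)

lemma cinner_self_eq_0 [simp]: "cinner x x = 0 \<longleftrightarrow> x = 0"
  by (simp add: cinner_self)

lemma cinner_eq_0_commute: "cinner x y = 0 \<longleftrightarrow> cinner y x = 0"
  by (metis cinner_commute complex_cnj_zero_iff)

lemma cmod_cinner_commute: "cmod (cinner x y) = cmod (cinner y x)"
  by (metis cinner_commute complex_mod_cnj)

lemma cinner_ext_left: "(\<And>y. cinner x y = cinner x' y) \<Longrightarrow> x = x'"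
  by (metis cinner_diff_left cinner_self_eq_0 right_minus_eq)

lemma norm_scaleC [simp]: "norm (c *\<^sub>C x) = cmod c * norm (x::'a::complex_inner)"
proof -
  have "complex_of_real ((norm (c *\<^sub>C x))\<^sup>2) = complex_of_real ((cmod c * norm x)\<^sup>2)"
  proof -
    have "cinner (c *\<^sub>C x) (c *\<^sub>C x) = (c * cnj c) * cinner x x"
      by (simp add: cinner_scaleC_left cinner_scaleC_right)
    then show ?thesis
      by (simp only: cinner_self power_mult_distrib of_real_mult flip: complex_norm_square)
  qed
  then show ?thesis
    by (metis of_real_eq_iff power2_eq_iff_nonneg norm_ge_zero mult_nonneg_nonneg)
qed

lemma cmod_cinner_le: "cmod (cinner x y) \<le> norm x * norm y"
proof (cases "cinner x y = 0")
  case False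
  define u where "u = cnj (cinner x y) / cmod (cinner x y)"
  have u: "cmod u = 1" "u * cinner x y = cmod (cinner x y)"
  proof -
    have "cnj (cinner x y) * cinner x y = complex_of_real (cmod (cinner x y) * cmod (cinner x y))"
      by (simp only: mult.commute[of "cnj _"] power2_eq_square flip: complex_norm_square)
    with False show "u * cinner x y = cmod (cinner x y)"
      by (simp add: u_def)
  qed (use False in \<open>simp add: u_def norm_divide\<close>)
  have "cmod (cinner x y) = Re (cinner x (u *\<^sub>C y))"
    by (simp add: cinner_scaleC_right u(2))
  also have "\<dots> \<le> norm x * norm (u *\<^sub>C y)"
    unfolding Re_cinner by (rule norm_cauchy_schwarz)
  finally show ?thesis
    by (simp add: u(1))
qed simp

lemma bounded_linear_cinner_right: "bounded_linear (cinner x)"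
  by (rule bounded_linear_intro[where K = "norm x"])
    (simp_all add: cinner_add_right cinner_scaleR_right cmod_cinner_le mult.commute[of _ "norm x"])

lemma bounded_linear_cinner_left: "bounded_linear (\<lambda>x. cinner x y)"
  by (rule bounded_linear_intro[where K = "norm y"])
    (simp_all add: cinner_add_left cinner_scaleR_left cmod_cinner_le)

lemma bounded_linear_scaleC_left: "bounded_linear (\<lambda>c. c *\<^sub>C (x::'a::complex_inner))"
proof (rule bounded_linear_intro[where K = "norm x"])
  show "(r *\<^sub>R c) *\<^sub>C x = r *\<^sub>R (c *\<^sub>C x)" for r c
    by (metis scaleC_of_real scaleC_scaleC scaleR_conv_of_real)
qed (simp_all add: scaleC_add_left)

section \<open>Orthonormal sets and bases\<close>

abbreviation orthonormal_set :: "'a::complex_inner set \<Rightarrow> bool"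
  where "orthonormal_set \<equiv> orthonormal_family (\<lambda>e. e)"

lemma orthonormal_family_image:
  assumes "orthonormal_family \<phi> J"
  shows "inj_on \<phi> J" "orthonormal_set (\<phi> ` J)"
proof -
  show "inj_on \<phi> J"
  proof (rule inj_onI)
    fix i j assume "i \<in> J" "j \<in> J" "\<phi> i = \<phi> j"
    then have "(if i = j then 1 else 0 :: complex) = 1"
      using assms unfolding orthonormal_family_def by metis
    then show "i = j"
      by (simp split: if_splits)
  qed
  then show "orthonormal_set (\<phi> ` J)"
    using assms by (auto simp: orthonormal_family_def inj_on_eq_iff)
qed

lemma orthonormal_family_subset: "orthonormal_family \<phi> J \<Longrightarrow> I \<subseteq> J \<Longrightarrow> orthonormal_family \<phi> I"
  by (auto simp: orthonormal_family_def subset_iff)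

lemma orthonormal_family_norm: "orthonormal_family \<phi> J \<Longrightarrow> j \<in> J \<Longrightarrow> norm (\<phi> j) = 1"
  by (simp add: orthonormal_family_def norm_eq_sqrt_inner flip: Re_cinner)

lemma cinner_orthonormal_sum:
  assumes "orthonormal_set B" "finite F" "F \<subseteq> B" "e \<in> B"
  shows "cinner e (\<Sum>f\<in>F. c f *\<^sub>C f) = (if e \<in> F then c e else 0)"
proof -
  have "cinner e (\<Sum>f\<in>F. c f *\<^sub>C f) = (\<Sum>f\<in>F. if f = e then c e else 0)"
    unfolding cinner_sum_right
    using assms by (intro sum.cong) (auto simp: cinner_scaleC_right orthonormal_family_def subset_iff)
  then show ?thesis
    using assms(2) by simp
qed

lemma norm_orthonormal_sum:
  assumes "orthonormal_set B" "finite F" "F \<subseteq> B"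
  shows "(norm (\<Sum>e\<in>F. c e *\<^sub>C e))\<^sup>2 = (\<Sum>e\<in>F. (cmod (c e))\<^sup>2)"
proof -
  let ?s = "\<Sum>e\<in>F. c e *\<^sub>C e"
  have "complex_of_real ((norm ?s)\<^sup>2) = cinner ?s ?s"
    by (simp only: cinner_self)
  also have "\<dots> = (\<Sum>e\<in>F. cnj (c e) * cinner e ?s)"
    by (subst cinner_sum_left) (simp only: cinner_scaleC_left)
  also have "\<dots> = (\<Sum>e\<in>F. complex_of_real ((cmod (c e))\<^sup>2))"
  proof (rule sum.cong[OF refl])
    fix e assume "e \<in> F"
    then have "cinner e ?s = c e"
      using cinner_orthonormal_sum[OF assms, of e c] assms(3) by auto
    then show "cnj (c e) * cinner e ?s = complex_of_real ((cmod (c e))\<^sup>2)"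
      by (simp only: complex_norm_square mult.commute[of "cnj _"])
  qed
  finally have "complex_of_real ((norm ?s)\<^sup>2) = complex_of_real (\<Sum>e\<in>F. (cmod (c e))\<^sup>2)"
    by (simp only: of_real_sum)
  then show ?thesis
    by (simp only: of_real_eq_iff)
qed

lemma bessel_finite:
  assumes "orthonormal_set B" "finite F" "F \<subseteq> B"
  shows "(\<Sum>e\<in>F. (cmod (cinner e x))\<^sup>2) \<le> (norm x)\<^sup>2"
proof -
  let ?p = "\<Sum>e\<in>F. cinner e x *\<^sub>C e"
  have "cinner ?p (x - ?p) = (\<Sum>e\<in>F. cnj (cinner e x) * (cinner e x - cinner e ?p))"
    by (subst cinner_sum_left) (simp add: cinner_scaleC_left cinner_diff_right right_diff_distrib)
  also have "\<dots> = 0"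
  proof (rule sum.neutral, rule ballI)
    fix e assume "e \<in> F"
    then show "cnj (cinner e x) * (cinner e x - cinner e ?p) = 0"
      using cinner_orthonormal_sum[OF assms, of e "\<lambda>e. cinner e x"] assms(3) by auto
  qed
  finally have "inner ?p (x - ?p) = 0"
    by (simp flip: Re_cinner)
  then have "(norm (?p + (x - ?p)))\<^sup>2 = (norm ?p)\<^sup>2 + (norm (x - ?p))\<^sup>2"
    by (intro norm_add_Pythagorean) (simp add: orthogonal_def)
  then show ?thesis
    using norm_orthonormal_sum[OF assms, of "\<lambda>e. cinner e x"] by simp
qed

lemma bessel_summable:
  assumes "orthonormal_set B"
  shows "(\<lambda>e. (cmod (cinner e x))\<^sup>2) summable_on B"
proof (rule nonneg_bounded_partial_sums_imp_summable_on)
  show "\<forall>\<^sub>F F in finite_subsets_at_top B. (\<Sum>e\<in>F. (cmod (cinner e x))\<^sup>2) \<le> (norm x)\<^sup>2"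
    by (rule eventually_finite_subsets_at_top_weakI) (use bessel_finite[OF assms] in blast)
qed simp

text \<open>
  The Cauchy criterion for the net of finite partial sums: beyond a finite \<open>F\<^sub>0\<close> that carries all
  but \<open>\<delta>\<^sup>2\<close> of \<open>\<Sum>|c\<^sub>e|\<^sup>2\<close>, Pythagoras bounds the distance to the partial sum over \<open>F\<^sub>0\<close> by \<open>\<delta>\<close>.
\<close>

lemma orthonormal_series_summable:
  fixes B :: "'a::chilbert_space set"
  assumes B: "orthonormal_set B" and c: "(\<lambda>e. (cmod (c e))\<^sup>2) summable_on B"
  shows "(\<lambda>e. c e *\<^sub>C e) summable_on B"
proof -
  define L where "L = infsum (\<lambda>e. (cmod (c e))\<^sup>2) B"
  have L: "((\<lambda>e. (cmod (c e))\<^sup>2) has_sum L) B"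
    using c by (simp add: L_def)
  let ?s = "\<lambda>F. \<Sum>e\<in>F. c e *\<^sub>C e"
  have "\<exists>P. eventually P (finite_subsets_at_top B) \<and> (\<forall>F F'. P F \<and> P F' \<longrightarrow> dist (?s F) (?s F') < \<epsilon>)"
    if "\<epsilon> > 0" for \<epsilon>
  proof -
    define \<delta> where "\<delta> = \<epsilon> / 2"
    have "\<delta> > 0" using that by (simp add: \<delta>_def)
    have "\<forall>\<^sub>F F in finite_subsets_at_top B. (\<Sum>e\<in>F. (cmod (c e))\<^sup>2) > L - \<delta>\<^sup>2"
      using L \<open>\<delta> > 0\<close> unfolding has_sum_def by (intro order_tendstoD(1)) auto
    then obtain F0 where F0: "finite F0" "F0 \<subseteq> B" "(\<Sum>e\<in>F0. (cmod (c e))\<^sup>2) > L - \<delta>\<^sup>2"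
      unfolding eventually_finite_subsets_at_top by blast
    define P where "P F \<longleftrightarrow> finite F \<and> F \<subseteq> B \<and> F0 \<subseteq> F" for F
    have P: "dist (?s F) (?s F0) < \<delta>" if "P F" for F
    proof -
      have "(dist (?s F) (?s F0))\<^sup>2 = (norm (?s (F - F0)))\<^sup>2"
        using that by (simp add: P_def dist_norm sum_diff)
      also have "\<dots> = (\<Sum>e\<in>F - F0. (cmod (c e))\<^sup>2)"
        using that by (intro norm_orthonormal_sum[OF B]) (auto simp: P_def)
      also have "\<dots> = (\<Sum>e\<in>F. (cmod (c e))\<^sup>2) - (\<Sum>e\<in>F0. (cmod (c e))\<^sup>2)"
        using that by (simp add: P_def sum_diff)
      also have "\<dots> < \<delta>\<^sup>2"
        using finite_sum_le_has_sum[OF L, of F] that F0(3) by (simp add: P_def)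
      finally show ?thesis
        using \<open>\<delta> > 0\<close> by (simp add: power2_less_imp_less)
    qed
    have "dist (?s F) (?s F') < \<epsilon>" if "P F" "P F'" for F F'
      using P[OF that(1)] P[OF that(2)] dist_triangle2[of "?s F" "?s F'" "?s F0"] by (simp add: \<delta>_def)
    moreover have "eventually P (finite_subsets_at_top B)"
      using F0 by (auto simp: P_def eventually_finite_subsets_at_top)
    ultimately show ?thesis
      by blast
  qed
  then have "cauchy_filter (filtermap ?s (finite_subsets_at_top B))"
    by (simp add: cauchy_filter_metric_filtermap)
  moreover have "complete (UNIV::'a set)"
    by (meson Cauchy_convergent UNIV_I complete_def convergent_def)
  ultimately obtain l where "(?s \<longlongrightarrow> l) (finite_subsets_at_top B)"
    using complete_uniform[where S = UNIV] by (force simp add: filterlim_def)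
  then show ?thesis
    using summable_on_def has_sum_def by blast
qed

lemma cinner_orthonormal_series:
  assumes B: "orthonormal_set B" and x: "((\<lambda>e. c e *\<^sub>C e) has_sum x) B" and e: "e \<in> B"
  shows "cinner e x = c e"
proof -
  have "((\<lambda>f. cinner e (c f *\<^sub>C f)) has_sum cinner e x) B"
    by (rule has_sum_bounded_linear[OF bounded_linear_cinner_right[of e] x])
  moreover have "((\<lambda>f. cinner e (c f *\<^sub>C f)) has_sum c e) B"
    using B e
    by (intro has_sum_finite_neutralI[where B = "{e}"])
      (auto simp: cinner_scaleC_right orthonormal_family_def)
  ultimately show ?thesis
    by (rule has_sum_unique)
qed

text \<open>The series converges by Bessel's inequality, and \<open>x\<close> minus its sum is orthogonal to \<open>B\<close>.\<close>

lemma orthonormal_expansion_if_total: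
  fixes B :: "'a::chilbert_space set"
  assumes B: "orthonormal_set B" and total: "\<And>y. (\<And>e. e \<in> B \<Longrightarrow> cinner e y = 0) \<Longrightarrow> y = 0"
  shows "((\<lambda>e. cinner e x *\<^sub>C e) has_sum x) B"
proof -
  obtain y where y: "((\<lambda>e. cinner e x *\<^sub>C e) has_sum y) B"
    using orthonormal_series_summable[OF B bessel_summable[OF B]] by (auto simp: summable_on_def)
  have "x - y = 0"
    by (rule total) (use cinner_orthonormal_series[OF B y] in \<open>simp add: cinner_diff_right\<close>)
  with y show ?thesis
    by simp
qed

lemma orthogonal_closure_span:
  assumes "\<And>e. e \<in> B \<Longrightarrow> cinner e x = 0" and "y \<in> closure (cmod.span B)"
  shows "cinner y x = 0"
proof -
  have "cinner y x = 0" if "y \<in> cmod.span B" for y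
    using that by (induction rule: cmod.span_induct_alt)
      (simp_all add: assms(1) cinner_add_left cinner_scaleC_left)
  then have "cmod.span B \<subseteq> (\<lambda>y. cinner y x) -` {0}"
    by auto
  moreover have "closed ((\<lambda>y. cinner y x) -` {0})"
    by (intro closed_vimage closed_singleton linear_continuous_on bounded_linear_cinner_left)
  ultimately have "closure (cmod.span B) \<subseteq> (\<lambda>y. cinner y x) -` {0}"
    by (rule closure_minimal)
  then show ?thesis
    using assms(2) by auto
qed

text \<open>Conversely to the density of the span giving totality, the finite partial sums of the expansion
  of \<open>x\<close> lie in the span and converge to \<open>x\<close>.\<close>

lemma is_onb_iff_total:
  fixes B :: "'a::chilbert_space set"
  shows "is_onb B \<longleftrightarrow> orthonormal_set B \<and> (\<forall>x. (\<forall>e\<in>B. cinner e x = 0) \<longrightarrow> x = 0)"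
proof
  assume B: "is_onb B"
  have "x = 0" if "\<forall>e\<in>B. cinner e x = 0" for x
  proof -
    have "x \<in> closure (cmod.span B)"
      using B by (simp add: is_onb_def)
    then have "cinner x x = 0"
      using that by (intro orthogonal_closure_span[of B x x]) auto
    then show ?thesis
      by simp
  qed
  with B show "orthonormal_set B \<and> (\<forall>x. (\<forall>e\<in>B. cinner e x = 0) \<longrightarrow> x = 0)"
    unfolding is_onb_def by blast
next
  assume *: "orthonormal_set B \<and> (\<forall>x. (\<forall>e\<in>B. cinner e x = 0) \<longrightarrow> x = 0)"
  have "x \<in> closure (cmod.span B)" for x
  proof (rule Lim_in_closed_set)
    have "((\<lambda>e. cinner e x *\<^sub>C e) has_sum x) B"
      by (rule orthonormal_expansion_if_total) (use * in blast)+
    then show "((\<lambda>F. \<Sum>e\<in>F. cinner e x *\<^sub>C e) \<longlongrightarrow> x) (finite_subsets_at_top B)"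
      by (simp add: has_sum_def)
    have "(\<Sum>e\<in>F. cinner e x *\<^sub>C e) \<in> closure (cmod.span B)" if "F \<subseteq> B" for F
      by (rule subsetD[OF closure_subset], intro cmod.span_sum cmod.span_scale cmod.span_base)
        (use that in blast)
    then show "\<forall>\<^sub>F F in finite_subsets_at_top B. (\<Sum>e\<in>F. cinner e x *\<^sub>C e) \<in> closure (cmod.span B)"
      by (rule eventually_finite_subsets_at_top_weakI)
  qed simp_all
  then show "is_onb B"
    unfolding is_onb_def using * by (intro conjI UNIV_eq_I[symmetric]) simp_all
qed

lemma onb_orthonormal: "is_onb B \<Longrightarrow> orthonormal_set B"
  by (simp add: is_onb_def)

lemma onb_norm: "is_onb B \<Longrightarrow> e \<in> B \<Longrightarrow> norm e = 1"
  using orthonormal_family_norm[OF onb_orthonormal] .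

lemma onb_expansion:
  fixes B :: "'a::chilbert_space set"
  assumes "is_onb B"
  shows "((\<lambda>e. cinner e x *\<^sub>C e) has_sum x) B"
  using assms unfolding is_onb_iff_total by (intro orthonormal_expansion_if_total) blast+

lemma parseval_cinner:
  fixes B :: "'a::chilbert_space set"
  assumes "is_onb B"
  shows "((\<lambda>e. cinner x e * cinner e y) has_sum cinner x y) B"
  using has_sum_bounded_linear[OF bounded_linear_cinner_right onb_expansion[OF assms], of x y]
  by (simp add: cinner_scaleC_right mult.commute)

lemma parseval_norm:
  fixes B :: "'a::chilbert_space set"
  assumes "is_onb B"
  shows "((\<lambda>e. (cmod (cinner e x))\<^sup>2) has_sum (norm x)\<^sup>2) B"
proof -
  have "cinner x e * cinner e x = complex_of_real ((cmod (cinner e x))\<^sup>2)" for e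
    by (subst (1) cinner_commute) (simp add: complex_norm_square mult.commute del: of_real_power)
  then show ?thesis
    using parseval_cinner[OF assms, of x x] by (simp only: cinner_self has_sum_of_real_iff)
qed

text \<open>An orthonormal set that is maximal under inclusion is total: a nonzero vector orthogonal to
  it could be normalized and added.\<close>

lemma orthonormal_set_extends_to_onb:
  fixes A :: "'a::chilbert_space set"
  assumes A: "orthonormal_set A"
  obtains B where "A \<subseteq> B" "is_onb B"
proof -
  let ?\<C> = "{B. A \<subseteq> B \<and> orthonormal_set B}"
  have "\<exists>B\<in>?\<C>. \<forall>C\<in>?\<C>. B \<subseteq> C \<longrightarrow> C = B"
  proof (rule subset_Zorn_nonempty)
    show "?\<C> \<noteq> {}"
      using A by auto
  next
    fix \<B> assume "\<B> \<noteq> {}" and chain: "subset.chain ?\<C> \<B>"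
    have sub: "\<And>B. B \<in> \<B> \<Longrightarrow> A \<subseteq> B \<and> orthonormal_set B"
      and comp: "\<And>B C. B \<in> \<B> \<Longrightarrow> C \<in> \<B> \<Longrightarrow> B \<subseteq> C \<or> C \<subseteq> B"
      using chain unfolding subset_chain_def by blast+
    have "orthonormal_set (\<Union>\<B>)"
      unfolding orthonormal_family_def
    proof (intro ballI)
      fix e f assume "e \<in> \<Union>\<B>" "f \<in> \<Union>\<B>"
      then obtain B C where BC: "B \<in> \<B>" "C \<in> \<B>" "e \<in> B" "f \<in> C"
        by blast
      from comp[OF BC(1,2)] obtain D where "D \<in> \<B>" "e \<in> D" "f \<in> D"
        using BC by blast
      then show "cinner e f = (if e = f then 1 else 0)"
        using sub unfolding orthonormal_family_def by blast
    qed
    moreover have "A \<subseteq> \<Union>\<B>"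
      using sub \<open>\<B> \<noteq> {}\<close> by blast
    ultimately show "\<Union>\<B> \<in> ?\<C>"
      by blast
  qed
  then obtain B where "B \<in> ?\<C>" and "\<forall>C\<in>?\<C>. B \<subseteq> C \<longrightarrow> C = B"
    by (rule bexE)
  then have B: "A \<subseteq> B" "orthonormal_set B"
    and max: "\<And>C. A \<subseteq> C \<Longrightarrow> orthonormal_set C \<Longrightarrow> B \<subseteq> C \<Longrightarrow> C = B"
    by simp_all
  have "x = 0" if x: "\<forall>e\<in>B. cinner e x = 0" for x
  proof (rule ccontr)
    assume "x \<noteq> 0"
    define u where "u = (1 / norm x) *\<^sub>R x"
    have "cinner u u = 1"
      using \<open>x \<noteq> 0\<close> by (simp add: u_def cinner_self)
    moreover have "cinner e u = 0" "cinner u e = 0" if "e \<in> B" for e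
      using x that cinner_eq_0_commute[of x e]
      by (simp_all add: u_def cinner_scaleR_right cinner_scaleR_left)
    moreover from calculation have "u \<notin> B"
      by (metis zero_neq_one)
    ultimately have "orthonormal_set (insert u B)"
      using B(2) unfolding orthonormal_family_def by (metis insert_iff)
    then have "insert u B = B"
      using B(1) by (intro max) auto
    with \<open>u \<notin> B\<close> show False
      by auto
  qed
  then have "is_onb B"
    using B(2) by (simp only: is_onb_iff_total) simp
  with B(1) show ?thesis
    by (rule that)
qed

corollary onb_exists: obtains B :: "'a::chilbert_space set" where "is_onb B"
  using orthonormal_set_extends_to_onb[of "{}"] by (auto simp: orthonormal_family_def)

section \<open>Adjoints\<close>

lemma bounded_clinear_bounded_linear: "bounded_clinear A \<Longrightarrow> bounded_linear A"
  by (simp add: bounded_clinear_def)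

lemma bounded_clinear_scaleC: "bounded_clinear A \<Longrightarrow> A (c *\<^sub>C x) = c *\<^sub>C A x"
  by (simp add: bounded_clinear_def)

lemma bounded_clinear_norm_le: "bounded_clinear A \<Longrightarrow> norm (A x) \<le> onorm A * norm x"
  by (rule onorm[OF bounded_clinear_bounded_linear])

lemma bounded_clinear_linear:
  assumes "bounded_clinear A"
  shows "A (x + y) = A x + A y" "A (x - y) = A x - A y" "A 0 = 0" "A (r *\<^sub>R x) = r *\<^sub>R A x"
    "A (sum g F) = (\<Sum>i\<in>F. A (g i))"
  using assms linear_add linear_diff linear_0 linear_scale linear_sum
  by (metis bounded_clinear_bounded_linear bounded_linear.linear)+

lemma bounded_clinear_compose:
  "bounded_clinear A \<Longrightarrow> bounded_clinear B \<Longrightarrow> bounded_clinear (A \<circ> B)"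
  by (simp add: bounded_clinear_def comp_def bounded_linear_compose)

lemma bounded_clinear_eq_on_onb:
  fixes A B :: "'a::chilbert_space \<Rightarrow> 'a"
  assumes "bounded_clinear A" "bounded_clinear B" "is_onb E" "\<And>e. e \<in> E \<Longrightarrow> A e = B e"
  shows "A = B"
proof
  fix x
  have "((\<lambda>e. cinner e x *\<^sub>C D e) has_sum D x) E" if D: "bounded_clinear D" for D :: "'a \<Rightarrow> 'a"
    using has_sum_bounded_linear[OF bounded_clinear_bounded_linear[OF D] onb_expansion[OF assms(3), of x]]
    by (simp only: bounded_clinear_scaleC[OF D])
  from this[OF assms(1)] this[OF assms(2)]
  have "((\<lambda>e. cinner e x *\<^sub>C A e) has_sum A x) E" "((\<lambda>e. cinner e x *\<^sub>C B e) has_sum B x) E" .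
  moreover have "((\<lambda>e. cinner e x *\<^sub>C A e) has_sum y) E = ((\<lambda>e. cinner e x *\<^sub>C B e) has_sum y) E" for y
    by (rule has_sum_cong) (simp add: assms(4))
  ultimately show "A x = B x"
    using has_sum_unique by blast
qed

text \<open>
  The Riesz representation theorem. In an orthonormal basis the representing vector has the
  coordinates \<open>cnj (f e)\<close>; they are square summable because testing \<open>f\<close> on a finite partial sum
  \<open>v\<close> gives \<open>\<parallel>v\<parallel>\<^sup>2 = f v \<le> K \<parallel>v\<parallel>\<close>.
\<close>

lemma riesz_representation:
  fixes f :: "'a::chilbert_space \<Rightarrow> complex"
  assumes f: "bounded_linear f" and f_scaleC: "\<And>c x. f (c *\<^sub>C x) = c * f x"
  shows "\<exists>y. \<forall>x. cinner y x = f x"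
proof -
  obtain B :: "'a set" where B: "is_onb B"
    by (rule onb_exists)
  have "(\<lambda>e. (cmod (cnj (f e)))\<^sup>2) summable_on B"
  proof (rule nonneg_bounded_partial_sums_imp_summable_on)
    have "(\<Sum>e\<in>F. (cmod (cnj (f e)))\<^sup>2) \<le> (onorm f)\<^sup>2" if F: "finite F" "F \<subseteq> B" for F
    proof -
      define v where "v = (\<Sum>e\<in>F. cnj (f e) *\<^sub>C e)"
      have nv: "(norm v)\<^sup>2 = (\<Sum>e\<in>F. (cmod (cnj (f e)))\<^sup>2)"
        unfolding v_def by (rule norm_orthonormal_sum[OF onb_orthonormal[OF B] F])
      have "f v = (\<Sum>e\<in>F. cnj (f e) * f e)"
        unfolding v_def using f by (simp add: linear_sum bounded_linear.linear f_scaleC)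
      also have "\<dots> = complex_of_real ((norm v)\<^sup>2)"
        unfolding nv of_real_sum
        by (rule sum.cong[OF refl]) (simp only: complex_mod_cnj complex_norm_square mult.commute)
      finally have "cmod (f v) = (norm v)\<^sup>2"
        by (simp add: norm_power)
      then have "norm v * norm v \<le> onorm f * norm v"
        using onorm[OF f, of v] by (simp add: power2_eq_square)
      then have "norm v \<le> onorm f"
        using onorm_pos_le[OF f] by (cases "norm v = 0") (auto simp: mult_le_cancel_right)
      then show ?thesis
        unfolding nv[symmetric] by (simp add: power_mono)
    qed
    then show "\<forall>\<^sub>F F in finite_subsets_at_top B. (\<Sum>e\<in>F. (cmod (cnj (f e)))\<^sup>2) \<le> (onorm f)\<^sup>2"
      by (rule eventually_finite_subsets_at_top_weakI)
  qed simp
  then obtain y where y: "((\<lambda>e. cnj (f e) *\<^sub>C e) has_sum y) B"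
    using orthonormal_series_summable[OF onb_orthonormal[OF B], of "\<lambda>e. cnj (f e)"]
    by (auto simp: summable_on_def)
  have "cinner y x = f x" for x
  proof (rule has_sum_unique)
    show "((\<lambda>e. f e * cinner e x) has_sum cinner y x) B"
      using has_sum_bounded_linear[OF bounded_linear_cinner_left[of x] y] by (simp add: cinner_scaleC_left)
    show "((\<lambda>e. f e * cinner e x) has_sum f x) B"
      using has_sum_bounded_linear[OF f onb_expansion[OF B, of x]] by (simp add: f_scaleC mult.commute)
  qed
  then show ?thesis
    by blast
qed

lemma cinner_adj_left:
  fixes A :: "'a::chilbert_space \<Rightarrow> 'a"
  assumes A: "bounded_clinear A"
  shows "cinner (adj A x) y = cinner x (A y)"
proof -
  have "\<exists>z. \<forall>y. cinner z y = cinner x (A y)" for x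
  proof (rule riesz_representation)
    show "bounded_linear (\<lambda>y. cinner x (A y))"
      by (rule bounded_linear_compose[OF bounded_linear_cinner_right
            bounded_clinear_bounded_linear[OF A]])
  qed (simp only: bounded_clinear_scaleC[OF A] cinner_scaleC_right)
  then have "\<exists>A'. \<forall>x y. cinner (A' x) y = cinner x (A y)"
    by (intro choice allI)
  then obtain A' where A': "\<And>x y. cinner (A' x) y = cinner x (A y)"
    by blast
  have "adj A = A'"
    unfolding adj_def
  proof (rule the_equality)
    show "B = A'" if "\<forall>x y. cinner (B x) y = cinner x (A y)" for B
      by (rule ext, rule cinner_ext_left) (use that in \<open>simp only: A'\<close>)
  qed (simp add: A')
  then show ?thesis
    by (simp only: A')
qed

lemma cinner_adj_right:
  fixes A :: "'a::chilbert_space \<Rightarrow> 'a"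
  shows "bounded_clinear A \<Longrightarrow> cinner x (adj A y) = cinner (A x) y"
  by (metis cinner_adj_left cinner_commute)

lemma adj_eqI:
  fixes A :: "'a::chilbert_space \<Rightarrow> 'a"
  assumes "bounded_clinear A" "\<And>x y. cinner (B x) y = cinner x (A y)"
  shows "adj A = B"
  by (rule ext, rule cinner_ext_left) (simp add: cinner_adj_left assms)

lemma bounded_clinear_adj:
  fixes A :: "'a::chilbert_space \<Rightarrow> 'a"
  assumes A: "bounded_clinear A"
  shows "bounded_clinear (adj A)"
  unfolding bounded_clinear_def
proof (intro conjI allI bounded_linear_intro)
  fix x y c r
  show "adj A (x + y) = adj A x + adj A y"
    by (rule cinner_ext_left) (simp add: cinner_adj_left[OF A] cinner_add_left)
  show "adj A (r *\<^sub>R x) = r *\<^sub>R adj A x"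
    by (rule cinner_ext_left) (simp add: cinner_adj_left[OF A] cinner_scaleR_left)
  show "adj A (c *\<^sub>C x) = c *\<^sub>C adj A x"
    by (rule cinner_ext_left) (simp add: cinner_adj_left[OF A] cinner_scaleC_left)
  have "(norm (adj A x))\<^sup>2 = cmod (cinner x (A (adj A x)))"
    unfolding cinner_adj_left[OF A, symmetric] by (simp add: cinner_self norm_power)
  also have "\<dots> \<le> norm x * norm (A (adj A x))"
    by (rule cmod_cinner_le)
  also have "\<dots> \<le> norm x * (onorm A * norm (adj A x))"
    by (intro mult_left_mono bounded_clinear_norm_le[OF A]) simp
  finally have "norm (adj A x) * norm (adj A x) \<le> (norm x * onorm A) * norm (adj A x)"
    by (simp add: power2_eq_square mult.assoc)
  moreover have "0 \<le> norm x * onorm A"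
    using A by (simp add: bounded_clinear_def onorm_pos_le)
  ultimately show "norm (adj A x) \<le> norm x * onorm A"
    by (cases "norm (adj A x) = 0") (auto simp: mult_le_cancel_right)
qed

lemma adj_adj: "bounded_clinear A \<Longrightarrow> adj (adj A) = (A :: 'a::chilbert_space \<Rightarrow> 'a)"
  by (intro adj_eqI bounded_clinear_adj) (simp_all add: cinner_adj_right)

lemma adj_compose:
  fixes A B :: "'a::chilbert_space \<Rightarrow> 'a"
  assumes "bounded_clinear A" "bounded_clinear B"
  shows "adj (A \<circ> B) = adj B \<circ> adj A"
  using assms by (intro adj_eqI bounded_clinear_compose) (simp_all add: cinner_adj_left)

lemma cinner_adj_compose_self:
  fixes A :: "'a::chilbert_space \<Rightarrow> 'a"
  shows "bounded_clinear A \<Longrightarrow> cinner x ((adj A \<circ> A) x) = complex_of_real ((norm (A x))\<^sup>2)"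
  by (simp add: cinner_adj_right cinner_self)

section \<open>Hilbert-Schmidt operators\<close>

lemma hilbert_schmidt_bounded_clinear: "hilbert_schmidt A \<Longrightarrow> bounded_clinear A"
  by (simp add: hilbert_schmidt_def)

lemma hilbert_schmidt_matrix_has_sum:
  fixes A :: "'a::chilbert_space \<Rightarrow> 'a"
  assumes "is_onb B" "is_onb C" "((\<lambda>e. (norm (A e))\<^sup>2) has_sum h) B"
  shows "((\<lambda>(e, f). (cmod (cinner f (A e)))\<^sup>2) has_sum h) (B \<times> C)"
proof -
  have row: "((\<lambda>f. (\<lambda>(e, f). (cmod (cinner f (A e)))\<^sup>2) (e, f)) has_sum (norm (A e))\<^sup>2) C" for e
    using parseval_norm[OF assms(2), of "A e"] by simp
  show ?thesis
  proof (rule has_sum_SigmaI[OF row assms(3)])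
    show "(\<lambda>(e, f). (cmod (cinner f (A e)))\<^sup>2) summable_on B \<times> C"
      by (rule summable_on_SigmaI[OF row has_sum_imp_summable[OF assms(3)]]) simp
  qed
qed

text \<open>Both sides are the sum of \<open>|\<langle>f, A e\<rangle>|\<^sup>2\<close> over \<open>B \<times> C\<close>, summed by rows and by columns.\<close>

lemma hilbert_schmidt_adj_has_sum:
  fixes A :: "'a::chilbert_space \<Rightarrow> 'a"
  assumes "bounded_clinear A" "is_onb B" "is_onb C" "((\<lambda>e. (norm (A e))\<^sup>2) has_sum h) B"
  shows "((\<lambda>f. (norm (adj A f))\<^sup>2) has_sum h) C"
proof (rule has_sum_SigmaD)
  show "((\<lambda>(f, e). (cmod (cinner f (A e)))\<^sup>2) has_sum h) (C \<times> B)"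
    using hilbert_schmidt_matrix_has_sum[OF assms(2-4)]
    by (subst (asm) has_sum_swap) (simp add: case_prod_unfold)
  show "((\<lambda>e. (\<lambda>(f, e). (cmod (cinner f (A e)))\<^sup>2) (f, e)) has_sum (norm (adj A f))\<^sup>2) B" for f
    using parseval_norm[OF assms(2), of "adj A f"]
    by (simp add: cinner_adj_right[OF assms(1)] cmod_cinner_commute)
qed

lemma hilbert_schmidt_adj:
  fixes A :: "'a::chilbert_space \<Rightarrow> 'a"
  assumes "hilbert_schmidt A"
  shows "hilbert_schmidt (adj A)"
  using assms hilbert_schmidt_adj_has_sum bounded_clinear_adj
  unfolding hilbert_schmidt_def summable_on_def by metis

lemma op_trace_eqI:
  fixes A :: "'a::chilbert_space \<Rightarrow> 'a"
  assumes "\<And>B. is_onb B \<Longrightarrow> ((\<lambda>e. cinner e (A e)) has_sum t) B"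
  shows "op_trace A = t"
  unfolding op_trace_def
proof (rule the_equality)
  obtain B :: "'a set" where "is_onb B"
    by (rule onb_exists)
  then show "s = t" if "\<forall>B. is_onb B \<longrightarrow> ((\<lambda>e. cinner e (A e)) has_sum s) B" for s
    using assms that has_sum_unique by blast
qed (use assms in blast)

text \<open>Going from \<open>A\<close> to \<open>A\<^sup>*\<close> and back replaces one orthonormal basis by another, so \<open>\<Sum>\<parallel>A e\<parallel>\<^sup>2\<close> does not
  depend on the basis and the trace of \<open>A\<^sup>* A\<close> is well defined.\<close>

lemma hs_norm_has_sum:
  fixes A :: "'a::chilbert_space \<Rightarrow> 'a"
  assumes A: "hilbert_schmidt A" and B: "is_onb B"
  shows "((\<lambda>e. (norm (A e))\<^sup>2) has_sum (hs_norm A)\<^sup>2) B"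
proof -
  note bl = hilbert_schmidt_bounded_clinear[OF A]
  obtain C h where "is_onb C" "((\<lambda>e. (norm (A e))\<^sup>2) has_sum h) C"
    using A by (auto simp: hilbert_schmidt_def summable_on_def)
  then have "((\<lambda>e. (norm (adj A e))\<^sup>2) has_sum h) C"
    by (intro hilbert_schmidt_adj_has_sum[OF bl])
  then have h: "((\<lambda>e. (norm (A e))\<^sup>2) has_sum h) B" if "is_onb B" for B
    using hilbert_schmidt_adj_has_sum[OF bounded_clinear_adj[OF bl] \<open>is_onb C\<close> that]
    by (simp add: adj_adj[OF bl])
  have "op_trace (adj A \<circ> A) = complex_of_real h"
    by (rule op_trace_eqI) (simp only: cinner_adj_compose_self[OF bl] has_sum_of_real_iff h)
  moreover have "h \<ge> 0"
    by (rule has_sum_nonneg[OF h[OF B]]) simp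
  ultimately show ?thesis
    using h[OF B] by (simp add: hs_norm_def)
qed

lemma hilbert_schmidt_compose_left:
  fixes A :: "'a::chilbert_space \<Rightarrow> 'a"
  assumes Q: "bounded_clinear Q" and A: "hilbert_schmidt A"
  shows "hilbert_schmidt (Q \<circ> A)"
proof -
  obtain B where B: "is_onb B" "(\<lambda>e. (norm (A e))\<^sup>2) summable_on B"
    using A by (auto simp: hilbert_schmidt_def)
  have "(norm (Q y))\<^sup>2 \<le> (onorm Q)\<^sup>2 * (norm y)\<^sup>2" for y
    using bounded_clinear_norm_le[OF Q, of y] by (metis norm_ge_zero power_mono power_mult_distrib)
  then have "(\<lambda>e. (norm ((Q \<circ> A) e))\<^sup>2) summable_on B"
    by (intro summable_on_comparison_test[OF summable_on_cmult_right[OF B(2), of "(onorm Q)\<^sup>2"]]) simp_all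
  with B(1) Q A show ?thesis
    by (auto simp: hilbert_schmidt_def intro: bounded_clinear_compose)
qed

lemma hilbert_schmidt_compose_right:
  fixes A :: "'a::chilbert_space \<Rightarrow> 'a"
  assumes "bounded_clinear Q" "hilbert_schmidt A"
  shows "hilbert_schmidt (A \<circ> Q)"
proof -
  note bl = assms(1) hilbert_schmidt_bounded_clinear[OF assms(2)]
  have "hilbert_schmidt (adj (adj Q \<circ> adj A))"
    using assms by (intro hilbert_schmidt_adj hilbert_schmidt_compose_left bounded_clinear_adj)
  then show ?thesis
    using bl by (simp add: adj_compose bounded_clinear_adj adj_adj)
qed

text \<open>
  This is \<open>tr (X\<^sup>* Y) = tr (Y X\<^sup>*)\<close> for Hilbert-Schmidt operators. As before, both sides
  are sums over \<open>B \<times> C\<close>, now of \<open>\<langle>X e, f\<rangle> \<langle>f, Y e\<rangle>\<close>, which converge absolutely since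
  \<open>2|ab| \<le> |a|\<^sup>2 + |b|\<^sup>2\<close>.
\<close>

lemma hilbert_schmidt_cinner_has_sum_adj:
  fixes X Y :: "'a::chilbert_space \<Rightarrow> 'a"
  assumes X: "hilbert_schmidt X" and Y: "hilbert_schmidt Y" and B: "is_onb B" and C: "is_onb C"
    and t: "((\<lambda>f. cinner (adj Y f) (adj X f)) has_sum t) C"
  shows "((\<lambda>e. cinner (X e) (Y e)) has_sum t) B"
proof -
  note bX = hilbert_schmidt_bounded_clinear[OF X] and bY = hilbert_schmidt_bounded_clinear[OF Y]
  define g where "g = (\<lambda>(e, f). cinner (X e) f * cinner f (Y e))"
  have "(\<lambda>p. norm (g p)) summable_on B \<times> C"
  proof (rule summable_on_comparison_test)
    show "(\<lambda>p. (case p of (e, f) \<Rightarrow> (cmod (cinner f (X e)))\<^sup>2) +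
        (case p of (e, f) \<Rightarrow> (cmod (cinner f (Y e)))\<^sup>2)) summable_on B \<times> C"
      by (rule summable_on_add; rule has_sum_imp_summable, rule hilbert_schmidt_matrix_has_sum[OF B C])
        (rule hs_norm_has_sum[OF X B] hs_norm_has_sum[OF Y B])+
    show "norm (g p) \<le> (case p of (e, f) \<Rightarrow> (cmod (cinner f (X e)))\<^sup>2) +
        (case p of (e, f) \<Rightarrow> (cmod (cinner f (Y e)))\<^sup>2)" for p
    proof (cases p)
      case (Pair e f)
      have "a * b \<le> a\<^sup>2 + b\<^sup>2" for a b :: real
        using sum_squares_bound[of a b] zero_le_power2[of a] zero_le_power2[of b]
          zero_le_power2[of "a + b"] by (simp add: power2_sum)
      then show ?thesis
        by (simp add: Pair g_def norm_mult cmod_cinner_commute[of "X e" f])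
    qed
  qed simp
  then obtain s where s: "(g has_sum s) (B \<times> C)"
    using abs_summable_summable by (auto simp: summable_on_def)
  have B': "((\<lambda>e. cinner (X e) (Y e)) has_sum s) B"
    by (rule has_sum_SigmaD[OF s]) (simp add: g_def parseval_cinner[OF C])
  have "((\<lambda>f. cinner (adj Y f) (adj X f)) has_sum s) C"
  proof (rule has_sum_SigmaD)
    show "((\<lambda>(f, e). g (e, f)) has_sum s) (C \<times> B)"
      using s by (subst (asm) has_sum_swap) (simp add: case_prod_unfold)
    show "((\<lambda>e. (\<lambda>(f, e). g (e, f)) (f, e)) has_sum cinner (adj Y f) (adj X f)) B" for f
      using parseval_cinner[OF B, of "adj Y f" "adj X f"]
      by (simp add: g_def cinner_adj_left[OF bY] cinner_adj_right[OF bX] mult.commute)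
  qed
  with t B' show ?thesis
    using has_sum_unique by blast
qed

text \<open>Here \<open>X = T\<^sup>* Q\<close> and \<open>Y = T\<^sup>*\<close>: then \<open>\<langle>X e, Y e\<rangle> = \<langle>e, Q T T\<^sup>* e\<rangle>\<close> and
  \<open>\<langle>Y\<^sup>* f, X\<^sup>* f\<rangle> = \<langle>T f, Q T f\<rangle> = \<parallel>Q T f\<parallel>\<^sup>2\<close>.\<close>

lemma hs_norm_projection_compose_has_sum:
  fixes T Q :: "'a::chilbert_space \<Rightarrow> 'a"
  assumes T: "hilbert_schmidt T" and Q: "bounded_clinear Q" "Q = adj Q" "Q = Q \<circ> Q" and B: "is_onb B"
  shows "((\<lambda>e. cinner e ((Q \<circ> (T \<circ> adj T)) e)) has_sum complex_of_real ((hs_norm (Q \<circ> T))\<^sup>2)) B"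
proof -
  note bT = hilbert_schmidt_bounded_clinear[OF T]
  have sa: "cinner (Q x) y = cinner x (Q y)" for x y
    using cinner_adj_left[OF Q(1), of x y] Q(2) by simp
  have idem: "Q (Q x) = Q x" for x
    using Q(3) by (metis comp_apply)
  have "((\<lambda>e. cinner ((adj T \<circ> Q) e) (adj T e)) has_sum complex_of_real ((hs_norm (Q \<circ> T))\<^sup>2)) B"
  proof (rule hilbert_schmidt_cinner_has_sum_adj[OF _ _ B B])
    show "hilbert_schmidt (adj T \<circ> Q)" "hilbert_schmidt (adj T)"
      using T Q(1) by (simp_all add: hilbert_schmidt_adj hilbert_schmidt_compose_right)
    have "cinner (adj (adj T) f) (adj (adj T \<circ> Q) f) = complex_of_real ((norm ((Q \<circ> T) f))\<^sup>2)" for f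
    proof -
      have "cinner (adj (adj T) f) (adj (adj T \<circ> Q) f) = cinner (T f) (Q (T f))"
        using bT Q(1) Q(2)[symmetric] by (simp add: adj_adj adj_compose bounded_clinear_adj)
      also have "\<dots> = cinner (Q (T f)) (Q (T f))"
        by (simp add: sa idem)
      finally show ?thesis
        by (simp add: cinner_self)
    qed
    then show "((\<lambda>f. cinner (adj (adj T) f) (adj (adj T \<circ> Q) f)) has_sum
        complex_of_real ((hs_norm (Q \<circ> T))\<^sup>2)) B"
      using hs_norm_has_sum[OF hilbert_schmidt_compose_left[OF Q(1) T] B]
      by (simp only: has_sum_of_real_iff)
  qed
  moreover have "cinner ((adj T \<circ> Q) e) (adj T e) = cinner e ((Q \<circ> (T \<circ> adj T)) e)" for e
    using bT by (simp add: cinner_adj_left sa)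
  ultimately show ?thesis
    by simp
qed

section \<open>The absolute value of a positive operator\<close>

lemma positive_op_self_adjoint:
  fixes P :: "'a::chilbert_space \<Rightarrow> 'a"
  assumes P: "positive_op P"
  shows "cinner (P x) y = cinner x (P y)"
proof -
  have bl: "bounded_clinear P"
    using P by (simp add: positive_op_def)
  \<comment> \<open>\<open>\<langle>z, P z\<rangle>\<close> is real; polarize with \<open>z = x + y\<close> and \<open>z = x + i y\<close>.\<close>
  have real: "cinner (P z) z = cinner z (P z)" for z
  proof -
    have "cinner z (P z) \<in> \<real>"
      using P nonneg_Reals_subset_Reals by (auto simp: positive_op_def)
    then have "cnj (cinner z (P z)) = cinner z (P z)"
      by (simp add: Reals_cnj_iff)
    then show ?thesis
      by (metis cinner_commute)
  qed
  define d where "d x y = cinner (P x) y - cinner x (P y)" for x y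
  have diag: "d z z = 0" for z
    by (simp add: d_def real)
  have add: "d (x + y) (x + y) = d x x + d x y + d y x + d y y" for x y
    by (simp add: d_def bounded_clinear_linear[OF bl] cinner_add_left cinner_add_right)
  have 1: "d x y + d y x = 0"
    using add[of x y] by (simp add: diag)
  have "d x (\<i> *\<^sub>C y) + d (\<i> *\<^sub>C y) x = 0"
    using add[of x "\<i> *\<^sub>C y"] by (simp add: diag)
  then have "\<i> * d x y - \<i> * d y x = 0"
    by (simp add: d_def bounded_clinear_scaleC[OF bl] cinner_scaleC_left cinner_scaleC_right algebra_simps)
  then have "d x y = d y x"
    by (simp flip: right_diff_distrib)
  with 1 have "d x y = 0"
    by simp
  then show ?thesis
    by (simp add: d_def)
qed

text \<open>Cauchy-Schwarz for the semi-inner product \<open>\<langle>x, P y\<rangle>\<close>, in the form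
  \<open>P\<^sup>2 \<le> \<parallel>P\<parallel> P\<close>. It follows from \<open>\<langle>z, P z\<rangle> \<ge> 0\<close> at \<open>z = \<parallel>P\<parallel> x - P x\<close>.\<close>

lemma positive_op_norm_le:
  fixes P :: "'a::chilbert_space \<Rightarrow> 'a"
  assumes P: "positive_op P"
  shows "(norm (P x))\<^sup>2 \<le> onorm P * inner x (P x)"
proof -
  have bl: "bounded_clinear P"
    using P by (simp add: positive_op_def)
  define K where "K = onorm P"
  have "K \<ge> 0"
    unfolding K_def by (rule onorm_pos_le[OF bounded_clinear_bounded_linear[OF bl]])
  have sa: "inner (P x) y = inner x (P y)" for x y
    using positive_op_self_adjoint[OF P, of x y] by (metis Re_cinner)
  have pos: "0 \<le> inner z (P z)" for z
    using P by (simp add: positive_op_def complex_nonneg_Reals_iff flip: Re_cinner)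
  show ?thesis
  proof (cases "K = 0")
    case True
    then have "norm (P x) \<le> 0"
      using bounded_clinear_norm_le[OF bl, of x] by (simp add: K_def)
    then show ?thesis
      by simp
  next
    case False
    with \<open>K \<ge> 0\<close> have "K > 0" by simp
    have "inner (P x) (P (P x)) \<le> norm (P x) * norm (P (P x))"
      by (rule norm_cauchy_schwarz)
    also have "\<dots> \<le> norm (P x) * (K * norm (P x))"
      unfolding K_def by (intro mult_left_mono bounded_clinear_norm_le[OF bl]) simp
    finally have "inner (P x) (P (P x)) \<le> K * (norm (P x))\<^sup>2"
      by (simp add: power2_eq_square algebra_simps)
    moreover have "0 \<le> inner (K *\<^sub>R x - P x) (P (K *\<^sub>R x - P x))"
      by (rule pos)
    then have "0 \<le> K * (K * inner x (P x)) - 2 * K * (norm (P x))\<^sup>2 + inner (P x) (P (P x))"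
      by (simp add: bounded_clinear_linear[OF bl] inner_diff_left inner_diff_right sa[symmetric]
          power2_norm_eq_inner)
        (simp add: algebra_simps sa inner_commute)
    ultimately have "0 \<le> K * (K * inner x (P x) - (norm (P x))\<^sup>2)"
      by (simp add: algebra_simps)
    with \<open>K > 0\<close> show ?thesis
      by (simp add: zero_le_mult_iff K_def)
  qed
qed

text \<open>
  Expand the square: \<open>\<langle>A\<^sup>* A x, x\<rangle> = \<parallel>A x\<parallel>\<^sup>2\<close>, and the hypotheses give \<open>\<parallel>A\<^sup>* A x\<parallel> \<le> s\<^sup>2\<close>. So if \<open>\<parallel>A x\<parallel>\<close> is
  close to \<open>s\<close>, then \<open>x\<close> is nearly an eigenvector of \<open>A\<^sup>* A\<close>.
\<close>

lemma norm_gram_diff_le: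
  fixes A :: "'a::chilbert_space \<Rightarrow> 'a"
  assumes A: "bounded_clinear A" and s: "s \<ge> 0"
    and x: "norm x = 1" "norm (A x) \<le> s" and AAx: "norm (A (adj A (A x))) \<le> s * norm (adj A (A x))"
  shows "(norm (adj A (A x) - s\<^sup>2 *\<^sub>R x))\<^sup>2 \<le> 2 * (s^4 - s\<^sup>2 * (norm (A x))\<^sup>2)"
proof -
  let ?S = "adj A (A x)"
  have Sx: "inner ?S x = (norm (A x))\<^sup>2"
    using cinner_adj_left[OF A, of "A x" x] by (simp add: cinner_self flip: Re_cinner)
  have "(norm ?S)\<^sup>2 = inner (A x) (A ?S)"
    using cinner_adj_left[OF A, of "A x" ?S] by (simp add: power2_norm_eq_inner flip: Re_cinner)
  also have "\<dots> \<le> norm (A x) * norm (A ?S)"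
    by (rule norm_cauchy_schwarz)
  also have "\<dots> \<le> s * (s * norm ?S)"
    using AAx x(2) s by (intro mult_mono) auto
  finally have "norm ?S * norm ?S \<le> s\<^sup>2 * norm ?S"
    by (simp add: power2_eq_square algebra_simps)
  then have "norm ?S \<le> s\<^sup>2"
    by (cases "norm ?S = 0") (auto simp: mult_le_cancel_right)
  then have "(norm ?S)\<^sup>2 \<le> (s\<^sup>2)\<^sup>2"
    by (intro power_mono) simp_all
  moreover have "(norm (?S - s\<^sup>2 *\<^sub>R x))\<^sup>2 = (norm ?S)\<^sup>2 - 2 * s\<^sup>2 * inner ?S x + (s\<^sup>2)\<^sup>2 * (norm x)\<^sup>2"
    unfolding power2_norm_eq_inner
    by (simp add: inner_diff_left inner_diff_right inner_commute power2_eq_square)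
  moreover have "(s\<^sup>2)\<^sup>2 = s^4"
    by (simp flip: power_mult)
  ultimately show ?thesis
    using Sx x(1) by simp
qed

text \<open>Here \<open>s\<close> is the supremum of \<open>\<parallel>A x\<parallel>\<close> over the unit vectors of \<open>M\<close>, and the \<open>X n\<close> nearly attain it.\<close>

lemma approximate_maximizers:
  fixes A :: "'a::chilbert_space \<Rightarrow> 'a"
  assumes A: "bounded_clinear A" and M: "\<And>x r. x \<in> M \<Longrightarrow> r *\<^sub>R x \<in> M"
    and inv: "\<And>x. x \<in> M \<Longrightarrow> adj A (A x) \<in> M" and nonzero: "\<exists>x\<in>M. A x \<noteq> 0"
  obtains s X where "s > 0" "\<And>x. x \<in> M \<Longrightarrow> norm (A x) \<le> s * norm x"
    "\<And>n::nat. X n \<in> M" "\<And>n. norm (X n) = 1" "(\<lambda>n. norm (A (X n))) \<longlonglongrightarrow> s"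
    "(\<lambda>n. adj A (A (X n)) - s\<^sup>2 *\<^sub>R X n) \<longlonglongrightarrow> 0"
proof -
  define V where "V = {norm (A x) |x. x \<in> M \<and> norm x = 1}"
  define s where "s = Sup V"
  have normalized: "(1 / norm x) *\<^sub>R x \<in> M" "norm ((1 / norm x) *\<^sub>R x) = 1"
    "norm (A ((1 / norm x) *\<^sub>R x)) = norm (A x) / norm x" if "x \<in> M" "x \<noteq> 0" for x
    using that M by (simp_all add: bounded_clinear_linear[OF A])
  have bdd: "bdd_above V"
  proof (rule bdd_aboveI)
    show "v \<le> onorm A" if v: "v \<in> V" for v
    proof -
      obtain x where "v = norm (A x)" "norm x = 1"
        using v by (auto simp: V_def)
      then show ?thesis
        using bounded_clinear_norm_le[OF A, of x] by simp
    qed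
  qed
  have V: "norm (A x) / norm x \<in> V" if "x \<in> M" "x \<noteq> 0" for x
    unfolding V_def using normalized[OF that] by force
  obtain x0 where x0: "x0 \<in> M" "A x0 \<noteq> 0"
    using nonzero by blast
  then have "x0 \<noteq> 0"
    by (auto simp: bounded_clinear_linear[OF A])
  with x0 have "V \<noteq> {}" "0 < norm (A x0) / norm x0"
    using V[of x0] by auto
  then have s: "s > 0"
    unfolding s_def using cSup_upper[OF V[OF x0(1) \<open>x0 \<noteq> 0\<close>] bdd] by linarith
  have le: "norm (A x) \<le> s * norm x" if "x \<in> M" for x
  proof (cases "x = 0")
    case False
    then show ?thesis
      using cSup_upper[OF V[OF that] bdd] by (simp add: s_def field_simps)
  qed (simp add: bounded_clinear_linear[OF A])
  have "\<exists>x. x \<in> M \<and> norm x = 1 \<and> s - inverse (real (Suc n)) < norm (A x)" for n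
  proof -
    have "s - inverse (real (Suc n)) < Sup V"
      by (simp add: s_def)
    then obtain v where "v \<in> V" "s - inverse (real (Suc n)) < v"
      using less_cSupD[OF \<open>V \<noteq> {}\<close>] by blast
    then show ?thesis
      by (auto simp: V_def)
  qed
  then obtain X where X: "\<And>n. X n \<in> M" "\<And>n. norm (X n) = 1"
      "\<And>n. s - inverse (real (Suc n)) < norm (A (X n))"
    by metis
  have lim: "(\<lambda>n. norm (A (X n))) \<longlonglongrightarrow> s"
  proof (rule tendsto_sandwich)
    show "(\<lambda>n. s - inverse (real (Suc n))) \<longlonglongrightarrow> s"
      using tendsto_diff[OF tendsto_const LIMSEQ_inverse_real_of_nat, of s] by simp
    show "\<forall>\<^sub>F n in sequentially. norm (A (X n)) \<le> s"
      using le[OF X(1)] X(2) by (intro always_eventually) simp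
  qed (use X(3) in \<open>auto intro!: always_eventually less_imp_le\<close>)
  have "(\<lambda>n. (norm (adj A (A (X n)) - s\<^sup>2 *\<^sub>R X n))\<^sup>2) \<longlonglongrightarrow> 0"
  proof (rule tendsto_sandwich[OF _ _ tendsto_const])
    show "\<forall>\<^sub>F n in sequentially. (norm (adj A (A (X n)) - s\<^sup>2 *\<^sub>R X n))\<^sup>2
        \<le> 2 * (s^4 - s\<^sup>2 * (norm (A (X n)))\<^sup>2)"
    proof (intro always_eventually allI norm_gram_diff_le[OF A])
      show "norm (A (X n)) \<le> s" for n
        using le[OF X(1)[of n]] by (simp add: X(2))
    qed (use s X le[OF inv[OF X(1)]] in auto)
    have "(\<lambda>n. 2 * (s^4 - s\<^sup>2 * (norm (A (X n)))\<^sup>2)) \<longlonglongrightarrow> 2 * (s^4 - s\<^sup>2 * s\<^sup>2)"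
      by (intro tendsto_intros lim)
    then show "(\<lambda>n. 2 * (s^4 - s\<^sup>2 * (norm (A (X n)))\<^sup>2)) \<longlonglongrightarrow> 0"
      by (simp flip: power_add)
  qed simp_all
  then have "(\<lambda>n. adj A (A (X n)) - s\<^sup>2 *\<^sub>R X n) \<longlonglongrightarrow> 0"
    by (simp add: tendsto_norm_zero_iff)
  with s le X(1,2) lim show ?thesis
    by (rule that)
qed

text \<open>
  Put \<open>D = P - R\<close> and \<open>W = P + R\<close>. From \<open>P\<^sup>2 = R\<^sup>2\<close> one gets \<open>W D = - D W\<close>, hence
  \<open>\<langle>D x, W D x\<rangle> = - \<langle>D\<^sup>2 x, W x\<rangle>\<close>. If \<open>D \<noteq> 0\<close>, take approximate eigenvectors \<open>x\<^sub>n\<close> of \<open>D\<^sup>2\<close> for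
  \<open>s\<^sup>2 = \<parallel>D\<parallel>\<^sup>2\<close>: the left side is nonnegative, and the right side differs from \<open>- s\<^sup>2 \<langle>x\<^sub>n, W x\<^sub>n\<rangle> \<le> 0\<close>
  by a null sequence. Hence both summands \<open>\<langle>D x\<^sub>n, P D x\<^sub>n\<rangle>\<close> and \<open>\<langle>D x\<^sub>n, R D x\<^sub>n\<rangle>\<close> of the left side
  tend to \<open>0\<close>. Then so do \<open>P D x\<^sub>n\<close>, \<open>R D x\<^sub>n\<close> and
  \<open>D\<^sup>2 x\<^sub>n\<close>, although \<open>\<parallel>D\<^sup>2 x\<^sub>n\<parallel> \<rightarrow> s\<^sup>2\<close>.
\<close>

lemma positive_op_square_root_unique:
  fixes P R :: "'a::chilbert_space \<Rightarrow> 'a"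
  assumes P: "positive_op P" and R: "positive_op R" and eq: "P \<circ> P = R \<circ> R"
  shows "P = R"
proof (rule ccontr)
  assume "P \<noteq> R"
  define D where "D x = P x - R x" for x
  have bP: "bounded_clinear P" and bR: "bounded_clinear R"
    using P R by (simp_all add: positive_op_def)
  have bD: "bounded_clinear D"
    using bP bR unfolding bounded_clinear_def D_def
    by (auto intro: bounded_linear_sub simp: cmod.scale_right_diff_distrib)
  note lin = bounded_clinear_linear[OF bP] bounded_clinear_linear[OF bR] bounded_clinear_linear[OF bD]
  have adjD: "adj D = D"
    by (rule adj_eqI[OF bD])
      (simp add: D_def cinner_diff_left cinner_diff_right positive_op_self_adjoint[OF P]
        positive_op_self_adjoint[OF R])
  have saD: "inner (D x) y = inner x (D y)" for x y
    using cinner_adj_left[OF bD, of x y] unfolding adjD by (metis Re_cinner)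
  have posP: "0 \<le> inner z (P z)" and posR: "0 \<le> inner z (R z)" for z
    using P R by (simp_all add: positive_op_def complex_nonneg_Reals_iff flip: Re_cinner)
  have "\<exists>x\<in>UNIV. D x \<noteq> 0"
    using \<open>P \<noteq> R\<close> by (auto simp: D_def fun_eq_iff)
  with UNIV_I UNIV_I obtain s X where s: "s > 0" and X: "\<And>n::nat. norm (X n) = 1"
    and lim: "(\<lambda>n. adj D (D (X n)) - s\<^sup>2 *\<^sub>R X n) \<longlonglongrightarrow> 0"
    by (rule approximate_maximizers[OF bD]) blast
  define Y where "Y n = D (D (X n)) - s\<^sup>2 *\<^sub>R X n" for n
  have Y: "Y \<longlonglongrightarrow> 0"
    using lim by (simp add: Y_def[abs_def] adjD)
  define W where "W x = P x + R x" for x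
  have WD: "W (D x) = - D (W x)" for x
    using fun_cong[OF eq, of x] by (simp add: W_def D_def lin)
  define a where "a n = inner (D (X n)) (W (D (X n)))" for n
  have a_le: "a n \<le> norm (Y n) * (onorm P + onorm R)" for n
  proof -
    have "a n = - inner (D (D (X n))) (W (X n))"
      by (simp add: a_def WD saD)
    also have "\<dots> = - inner (Y n) (W (X n)) - s\<^sup>2 * inner (X n) (W (X n))"
      by (simp add: Y_def inner_diff_left)
    also have "\<dots> \<le> - inner (Y n) (W (X n))"
      using posP[of "X n"] posR[of "X n"] by (simp add: W_def inner_add_right)
    also have "\<dots> \<le> norm (Y n) * norm (W (X n))"
      using norm_cauchy_schwarz[of "- Y n" "W (X n)"] by simp
    also have "norm (W (X n)) \<le> onorm P + onorm R"
      unfolding W_def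
      using norm_triangle_ineq[of "P (X n)" "R (X n)"] bounded_clinear_norm_le[OF bP, of "X n"]
        bounded_clinear_norm_le[OF bR, of "X n"] X[of n] by simp
    finally show ?thesis
      by (simp add: mult_left_mono)
  qed
  have a: "a n = inner (D (X n)) (P (D (X n))) + inner (D (X n)) (R (D (X n)))" for n
    by (simp add: a_def W_def inner_add_right)
  have a0: "a \<longlonglongrightarrow> 0"
  proof (rule tendsto_sandwich[OF _ _ tendsto_const])
    show "(\<lambda>n. norm (Y n) * (onorm P + onorm R)) \<longlonglongrightarrow> 0"
      using tendsto_mult_right[OF tendsto_norm[OF Y], of "onorm P + onorm R"] by simp
    show "\<forall>\<^sub>F n in sequentially. 0 \<le> a n"
      using posP posR by (simp add: a)
  qed (simp add: a_le)
  have small: "(\<lambda>n. T (D (X n))) \<longlonglongrightarrow> 0"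
    if T: "positive_op T" and le: "\<And>n. inner (D (X n)) (T (D (X n))) \<le> a n" for T
  proof -
    have "0 \<le> onorm T"
      using T by (intro onorm_pos_le) (simp add: positive_op_def bounded_clinear_def)
    then have bound: "(norm (T (D (X n))))\<^sup>2 \<le> onorm T * a n" for n
      by (rule order_trans[OF positive_op_norm_le[OF T] mult_left_mono[OF le]])
    have "(\<lambda>n. (norm (T (D (X n))))\<^sup>2) \<longlonglongrightarrow> 0"
    proof (rule tendsto_sandwich[OF _ _ tendsto_const])
      show "(\<lambda>n. onorm T * a n) \<longlonglongrightarrow> 0"
        using tendsto_mult_left[OF a0, of "onorm T"] by simp
    qed (simp_all add: bound)
    then show ?thesis
      by (simp add: tendsto_norm_zero_iff)
  qed
  have "(\<lambda>n. D (D (X n))) \<longlonglongrightarrow> 0 - 0"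
    unfolding D_def[of "D _"]
    using posP posR by (intro tendsto_diff small[OF P] small[OF R]) (simp_all add: a)
  then have "(\<lambda>n. norm (D (D (X n)) - Y n)) \<longlonglongrightarrow> norm (0 - 0 - 0 :: 'a)"
    using Y by (intro tendsto_intros)
  moreover have "norm (D (D (X n)) - Y n) = s\<^sup>2" for n
    by (simp add: Y_def X)
  ultimately show False
    using s by (simp add: LIMSEQ_const_iff)
qed

lemma positive_op_adj_compose_self:
  fixes T :: "'a::chilbert_space \<Rightarrow> 'a"
  assumes "bounded_clinear T"
  shows "positive_op (adj T \<circ> T)"
  unfolding positive_op_def
  using bounded_clinear_compose[OF bounded_clinear_adj[OF assms] assms]
  by (simp add: cinner_adj_compose_self[OF assms] del: comp_apply)

lemma abs_op_positive:
  fixes P :: "'a::chilbert_space \<Rightarrow> 'a"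
  assumes P: "positive_op P"
  shows "abs_op P = P"
  unfolding abs_op_def
proof (rule the_equality)
  have "adj P = P"
    using P by (intro adj_eqI) (simp_all add: positive_op_def positive_op_self_adjoint[OF P])
  with P show "positive_op P \<and> P \<circ> P = adj P \<circ> P"
    by simp
  then show "R = P" if "positive_op R \<and> R \<circ> R = adj P \<circ> P" for R
    using positive_op_square_root_unique[of R P] that by metis
qed

lemma hilbert_schmidt_iff_trace_class:
  fixes T :: "'a::chilbert_space \<Rightarrow> 'a"
  assumes T: "bounded_clinear T"
  shows "hilbert_schmidt T \<longleftrightarrow> trace_class (adj T \<circ> T)"
proof -
  have "(\<lambda>e. cinner e (abs_op (adj T \<circ> T) e)) summable_on B \<longleftrightarrow> (\<lambda>e. (norm (T e))\<^sup>2) summable_on B"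
    for B
  proof -
    have "(\<lambda>e. cinner e (abs_op (adj T \<circ> T) e)) = (\<lambda>e. complex_of_real ((norm (T e))\<^sup>2))"
      by (simp only: abs_op_positive[OF positive_op_adj_compose_self[OF T]] cinner_adj_compose_self[OF T])
    then show ?thesis
      using summable_on_Re[of "\<lambda>e. complex_of_real ((norm (T e))\<^sup>2)" B]
        summable_on_of_real[of "\<lambda>e. (norm (T e))\<^sup>2" B] by (auto simp del: of_real_power)
  qed
  then show ?thesis
    using T by (simp add: hilbert_schmidt_def trace_class_def bounded_clinear_compose bounded_clinear_adj)
qed

section \<open>Finite-rank orthogonal projections\<close>

definition orth_proj :: "'a::complex_inner set \<Rightarrow> 'a \<Rightarrow> 'a"
  where "orth_proj F x = (\<Sum>e\<in>F. rank_one e e x)"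

lemma bounded_clinear_rank_one: "bounded_clinear (rank_one u v)"
  unfolding bounded_clinear_def rank_one_def
proof (intro conjI allI)
  show "bounded_linear (\<lambda>w. cinner v w *\<^sub>C u)"
    by (rule bounded_linear_compose[OF bounded_linear_scaleC_left bounded_linear_cinner_right])
qed (simp add: cinner_scaleC_right)

lemma bounded_clinear_sum:
  assumes "\<And>i. i \<in> I \<Longrightarrow> bounded_clinear (f i)"
  shows "bounded_clinear (\<lambda>x. \<Sum>i\<in>I. f i x)"
  using assms unfolding bounded_clinear_def
  by (auto intro: bounded_linear_sum simp: cmod.scale_sum_right)

lemma bounded_clinear_orth_proj: "bounded_clinear (orth_proj F)"
  unfolding orth_proj_def[abs_def] by (intro bounded_clinear_sum bounded_clinear_rank_one)

lemma adj_orth_proj: "adj (orth_proj F) = orth_proj (F :: 'a::chilbert_space set)"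
proof (rule adj_eqI[OF bounded_clinear_orth_proj])
  have "cinner (cinner e x *\<^sub>C e) y = cinner x (cinner e y *\<^sub>C e)" for e x y :: 'a
    by (simp add: cinner_scaleC_left cinner_scaleC_right cinner_commute[of x e])
  then show "cinner (orth_proj F x) y = cinner x (orth_proj F y)" for x y
    by (simp add: orth_proj_def rank_one_def cinner_sum_left cinner_sum_right)
qed

lemma cinner_orth_proj:
  assumes "orthonormal_set B" "finite F" "F \<subseteq> B" "e \<in> B"
  shows "cinner e (orth_proj F x) = (if e \<in> F then cinner e x else 0)"
  unfolding orth_proj_def rank_one_def by (rule cinner_orthonormal_sum[OF assms])

lemma orth_proj_fixes:
  assumes "orthonormal_set B" "finite F" "F \<subseteq> B" "e \<in> B"
  shows "orth_proj F e = (if e \<in> F then e else 0)"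
proof -
  have "orth_proj F e = (\<Sum>f\<in>F. if f = e then e else 0)"
    unfolding orth_proj_def rank_one_def
    using assms by (intro sum.cong) (auto simp: orthonormal_family_def subset_iff)
  then show ?thesis
    using assms(2) by simp
qed

lemma orth_proj_idem:
  assumes "orthonormal_set F" "finite F"
  shows "orth_proj F (orth_proj F x) = orth_proj F x"
proof -
  have "rank_one e e (orth_proj F x) = rank_one e e x" if "e \<in> F" for e
    using cinner_orth_proj[OF assms order_refl that] that by (simp add: rank_one_def)
  then have "(\<Sum>e\<in>F. rank_one e e (orth_proj F x)) = (\<Sum>e\<in>F. rank_one e e x)"
    by (rule sum.cong[OF refl])
  then show ?thesis
    by (simp only: orth_proj_def[symmetric])
qed

lemma norm_diff_orth_proj_le:
  assumes "orthonormal_set F" "finite F"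
  shows "norm (x - orth_proj F x) \<le> norm x"
proof -
  have "cinner (orth_proj F x) (x - orth_proj F x)
      = (\<Sum>e\<in>F. cnj (cinner e x) * (cinner e x - cinner e (orth_proj F x)))"
    unfolding orth_proj_def[of F x] rank_one_def
    by (subst cinner_sum_left) (simp add: cinner_scaleC_left cinner_diff_right right_diff_distrib)
  also have "\<dots> = 0"
    by (rule sum.neutral) (simp add: cinner_orth_proj[OF assms order_refl])
  finally have "inner (orth_proj F x) (x - orth_proj F x) = 0"
    by (simp flip: Re_cinner)
  then have "(norm (orth_proj F x + (x - orth_proj F x)))\<^sup>2
      = (norm (orth_proj F x))\<^sup>2 + (norm (x - orth_proj F x))\<^sup>2"
    by (intro norm_add_Pythagorean) (simp add: orthogonal_def)
  then have "(norm (x - orth_proj F x))\<^sup>2 \<le> (norm x)\<^sup>2"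
    by simp
  then show ?thesis
    by (rule power2_le_imp_le) simp
qed

lemma hs_projection_orth_proj:
  fixes F :: "'a::chilbert_space set"
  assumes F: "orthonormal_set F" "finite F"
  shows "hs_projection (card F) (orth_proj F)"
proof -
  obtain B where B: "F \<subseteq> B" "is_onb B"
    by (rule orthonormal_set_extends_to_onb[OF F(1)])
  have sum: "((\<lambda>e. (norm (orth_proj F e))\<^sup>2) has_sum real (card F)) B"
    by (rule has_sum_finite_neutralI[OF F(2) B(1)])
      (simp_all add: orth_proj_fixes[OF onb_orthonormal[OF B(2)] F(2) B(1)]
        orthonormal_family_norm[OF F(1)] subsetD[OF B(1)])
  then have hs: "hilbert_schmidt (orth_proj F)"
    using B(2) bounded_clinear_orth_proj has_sum_imp_summable unfolding hilbert_schmidt_def by blast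
  moreover have "(hs_norm (orth_proj F))\<^sup>2 = real (card F)"
    using hs_norm_has_sum[OF hs B(2)] sum by (rule has_sum_unique)
  moreover have "orth_proj F = orth_proj F \<circ> orth_proj F"
    by (simp add: fun_eq_iff orth_proj_idem[OF F])
  ultimately show ?thesis
    by (simp add: hs_projection_def adj_orth_proj)
qed

section \<open>Compactness of Hilbert-Schmidt operators\<close>

text \<open>A unit vector is part of an orthonormal basis.\<close>

lemma norm_le_hs_norm:
  fixes A :: "'a::chilbert_space \<Rightarrow> 'a"
  assumes A: "hilbert_schmidt A"
  shows "(norm (A x))\<^sup>2 \<le> (hs_norm A)\<^sup>2 * (norm x)\<^sup>2"
proof (cases "x = 0")
  case True
  then show ?thesis
    by (simp add: bounded_clinear_linear[OF hilbert_schmidt_bounded_clinear[OF A]])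
next
  case False
  define u where "u = (1 / norm x) *\<^sub>R x"
  have "norm u = 1"
    using False by (simp add: u_def)
  then have "orthonormal_set {u}"
    by (simp add: orthonormal_family_def cinner_self)
  then obtain B where B: "{u} \<subseteq> B" "is_onb B"
    by (rule orthonormal_set_extends_to_onb)
  have "(norm (A u))\<^sup>2 \<le> (hs_norm A)\<^sup>2"
    using finite_sum_le_has_sum[OF hs_norm_has_sum[OF A B(2)], of "{u}"] B(1) by simp
  moreover have "A u = (1 / norm x) *\<^sub>R A x"
    by (simp add: u_def bounded_clinear_linear[OF hilbert_schmidt_bounded_clinear[OF A]])
  ultimately show ?thesis
    using False by (simp add: power_divide field_simps)
qed

lemma compact_finite_combinations:
  fixes v :: "'i \<Rightarrow> 'a::complex_inner"
  assumes "finite F"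
  shows "compact {\<Sum>e\<in>F. c e *\<^sub>C v e |c. \<forall>e\<in>F. cmod (c e) \<le> 1}"
  using assms
proof (induction F rule: finite_induct)
  case (insert i F)
  let ?K = "\<lambda>F. {\<Sum>e\<in>F. c e *\<^sub>C v e |c. \<forall>e\<in>F. cmod (c e) \<le> 1}"
  let ?L = "(\<lambda>c. c *\<^sub>C v i) ` cball 0 1"
  have "?K (insert i F) = {x + y |x y. x \<in> ?L \<and> y \<in> ?K F}"
  proof (intro equalityI subsetI)
    fix z assume "z \<in> ?K (insert i F)"
    then obtain c where c: "z = (\<Sum>e\<in>insert i F. c e *\<^sub>C v e)" "\<forall>e\<in>insert i F. cmod (c e) \<le> 1"
      by blast
    then have "z = c i *\<^sub>C v i + (\<Sum>e\<in>F. c e *\<^sub>C v e)"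
      using insert.hyps by simp
    moreover have "c i *\<^sub>C v i \<in> ?L" "(\<Sum>e\<in>F. c e *\<^sub>C v e) \<in> ?K F"
      using c(2) by auto
    ultimately show "z \<in> {x + y |x y. x \<in> ?L \<and> y \<in> ?K F}"
      by blast
  next
    fix z assume "z \<in> {x + y |x y. x \<in> ?L \<and> y \<in> ?K F}"
    then obtain a c where ac: "z = a *\<^sub>C v i + (\<Sum>e\<in>F. c e *\<^sub>C v e)" "cmod a \<le> 1" "\<forall>e\<in>F. cmod (c e) \<le> 1"
      by auto
    have "z = (\<Sum>e\<in>insert i F. (c(i := a)) e *\<^sub>C v e)"
      unfolding ac(1) using insert.hyps
      by (simp, intro sum.cong) auto
    moreover have "\<forall>e\<in>insert i F. cmod ((c(i := a)) e) \<le> 1"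
      using ac by simp
    ultimately show "z \<in> ?K (insert i F)"
      by blast
  qed
  moreover have "compact ?L"
    by (intro compact_continuous_image linear_continuous_on bounded_linear_scaleC_left compact_cball)
  ultimately show ?case
    using insert.IH by (simp only: compact_sums)
qed simp

text \<open>
  Up to an arbitrarily small error, controlled by the tail of \<open>\<Sum>\<parallel>A e\<parallel>\<^sup>2\<close>, the operator factors through a
  finite-rank projection, and finite combinations with bounded coefficients form a compact set.
\<close>

lemma hilbert_schmidt_compact:
  fixes A :: "'a::chilbert_space \<Rightarrow> 'a"
  assumes A: "hilbert_schmidt A"
  shows "compact (closure (A ` cball 0 1))"
  unfolding compact_eq_totally_bounded
proof (intro conjI allI impI)
  show "complete (closure (A ` cball 0 1))"
    by (simp add: complete_eq_closed)
  fix \<epsilon> :: real assume "\<epsilon> > 0"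
  define \<delta> where "\<delta> = \<epsilon> / 3"
  have \<delta>: "\<delta> > 0"
    using \<open>\<epsilon> > 0\<close> by (simp add: \<delta>_def)
  note bA = hilbert_schmidt_bounded_clinear[OF A]
  obtain B :: "'a set" where B: "is_onb B"
    by (rule onb_exists)
  note total = hs_norm_has_sum[OF A B]
  have "\<forall>\<^sub>F F in finite_subsets_at_top B. (\<Sum>e\<in>F. (norm (A e))\<^sup>2) > (hs_norm A)\<^sup>2 - \<delta>\<^sup>2"
    using total \<delta> unfolding has_sum_def by (intro order_tendstoD(1)) auto
  then obtain F where F: "finite F" "F \<subseteq> B" "(\<Sum>e\<in>F. (norm (A e))\<^sup>2) > (hs_norm A)\<^sup>2 - \<delta>\<^sup>2"
    unfolding eventually_finite_subsets_at_top by blast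
  define R where "R x = x - orth_proj F x" for x
  have bR: "bounded_clinear R"
    using bounded_clinear_orth_proj[of F] unfolding bounded_clinear_def R_def
    by (auto intro: bounded_linear_sub bounded_linear_ident simp: cmod.scale_right_diff_distrib)
  have RA: "hilbert_schmidt (A \<circ> R)"
    by (rule hilbert_schmidt_compose_right[OF bR A])
  have "(hs_norm (A \<circ> R))\<^sup>2 < \<delta>\<^sup>2"
  proof -
    have "((\<lambda>e. if e \<in> F then (norm (A e))\<^sup>2 else 0) has_sum (\<Sum>e\<in>F. (norm (A e))\<^sup>2)) B"
      by (rule has_sum_finite_neutralI[OF F(1,2)]) simp_all
    from has_sum_add[OF hs_norm_has_sum[OF RA B] this]
    have "((\<lambda>e. (norm ((A \<circ> R) e))\<^sup>2 + (if e \<in> F then (norm (A e))\<^sup>2 else 0)) has_sum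
        (hs_norm (A \<circ> R))\<^sup>2 + (\<Sum>e\<in>F. (norm (A e))\<^sup>2)) B" .
    moreover have "(norm ((A \<circ> R) e))\<^sup>2 + (if e \<in> F then (norm (A e))\<^sup>2 else 0) = (norm (A e))\<^sup>2"
      if "e \<in> B" for e
      by (simp add: R_def orth_proj_fixes[OF onb_orthonormal[OF B] F(1,2) that] bounded_clinear_linear[OF bA])
    ultimately have "((\<lambda>e. (norm (A e))\<^sup>2) has_sum (hs_norm (A \<circ> R))\<^sup>2 + (\<Sum>e\<in>F. (norm (A e))\<^sup>2)) B"
      by (simp cong: has_sum_cong)
    then have "(hs_norm (A \<circ> R))\<^sup>2 + (\<Sum>e\<in>F. (norm (A e))\<^sup>2) = (hs_norm A)\<^sup>2"
      using total by (rule has_sum_unique)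
    with F(3) show ?thesis
      by simp
  qed
  then have small: "norm (A (R x)) < \<delta>" if "norm x \<le> 1" for x
  proof -
    have "(norm (A (R x)))\<^sup>2 \<le> (hs_norm (A \<circ> R))\<^sup>2 * (norm x)\<^sup>2"
      using norm_le_hs_norm[OF RA, of x] by simp
    also have "\<dots> \<le> (hs_norm (A \<circ> R))\<^sup>2"
      using that by (simp add: mult_left_le power_le_one)
    finally show ?thesis
      using \<open>(hs_norm (A \<circ> R))\<^sup>2 < \<delta>\<^sup>2\<close> \<delta> by (meson le_less_trans less_imp_le power_less_imp_less_base)
  qed
  let ?K = "{\<Sum>e\<in>F. c e *\<^sub>C A e |c. \<forall>e\<in>F. cmod (c e) \<le> 1}"
  obtain k where k: "finite k" "?K \<subseteq> (\<Union>z\<in>k. ball z \<delta>)"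
    using compact_finite_combinations[OF F(1), of A] \<delta> unfolding compact_eq_totally_bounded by blast
  have "y \<in> (\<Union>z\<in>k. ball z \<epsilon>)" if y: "y \<in> closure (A ` cball 0 1)" for y
  proof -
    obtain x where x: "norm x \<le> 1" "dist (A x) y < \<delta>"
      using y \<delta> unfolding closure_approachable by auto
    have "A (orth_proj F x) = (\<Sum>e\<in>F. cinner e x *\<^sub>C A e)"
      unfolding orth_proj_def rank_one_def
      by (simp only: bounded_clinear_linear[OF bA] bounded_clinear_scaleC[OF bA])
    moreover have "cmod (cinner e x) \<le> 1" if "e \<in> F" for e
      using cmod_cinner_le[of e x] onb_norm[OF B subsetD[OF F(2) that]] x(1) by simp
    ultimately have "A (orth_proj F x) \<in> ?K"
      by (intro CollectI exI[of _ "\<lambda>e. cinner e x"]) simp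
    with k(2) obtain z where z: "z \<in> k" "dist z (A (orth_proj F x)) < \<delta>"
      by auto
    have "dist (A x) (A (orth_proj F x)) < \<delta>"
      using small[OF x(1)] by (simp add: dist_norm R_def bounded_clinear_linear[OF bA])
    then have "dist z y < \<epsilon>"
      using z(2) x(2) dist_triangle[of z y "A (orth_proj F x)"]
        dist_triangle3[of "A (orth_proj F x)" y "A x"] unfolding \<delta>_def by linarith
    with z(1) show ?thesis
      by auto
  qed
  with k(1) show "\<exists>k. finite k \<and> closure (A ` cball 0 1) \<subseteq> (\<Union>x\<in>k. ball x \<epsilon>)"
    by blast
qed

section \<open>The spectral representation\<close>

text \<open>The approximate maximizers have a subsequence along which \<open>A x\<^sub>n\<close> converges. Then so does
  \<open>s\<^sup>2 x\<^sub>n = A\<^sup>* A x\<^sub>n - (A\<^sup>* A x\<^sub>n - s\<^sup>2 x\<^sub>n)\<close>, and the limit is an eigenvector at which the maximum is attained.\<close>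

lemma maximal_eigenvector:
  fixes A :: "'a::chilbert_space \<Rightarrow> 'a"
  assumes A: "hilbert_schmidt A" and closed: "closed M" and M: "\<And>x r. x \<in> M \<Longrightarrow> r *\<^sub>R x \<in> M"
    and inv: "\<And>x. x \<in> M \<Longrightarrow> adj A (A x) \<in> M" and nonzero: "\<exists>x\<in>M. A x \<noteq> 0"
  shows "\<exists>\<phi>\<in>M. norm \<phi> = 1 \<and> adj A (A \<phi>) = (norm (A \<phi>))\<^sup>2 *\<^sub>R \<phi> \<and>
    (\<forall>x\<in>M. norm (A x) \<le> norm (A \<phi>) * norm x)"
proof -
  note bA = hilbert_schmidt_bounded_clinear[OF A]
  note blA = bounded_clinear_bounded_linear[OF bA]
    and blA' = bounded_clinear_bounded_linear[OF bounded_clinear_adj[OF bA]]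
  obtain s X where s: "s > 0" and le: "\<And>x. x \<in> M \<Longrightarrow> norm (A x) \<le> s * norm x"
    and X: "\<And>n::nat. X n \<in> M" "\<And>n. norm (X n) = 1" and lim: "(\<lambda>n. norm (A (X n))) \<longlonglongrightarrow> s"
    and ev: "(\<lambda>n. adj A (A (X n)) - s\<^sup>2 *\<^sub>R X n) \<longlonglongrightarrow> 0"
    using approximate_maximizers[OF bA M inv nonzero] by blast
  have "A (X n) \<in> closure (A ` cball 0 1)" for n
    using X(2)[of n] by (intro subsetD[OF closure_subset] imageI) simp
  then obtain l r where r: "strict_mono r" and l: "(\<lambda>n. A (X (r n))) \<longlonglongrightarrow> l"
    using hilbert_schmidt_compact[OF A] unfolding compact_def comp_def by meson
  have evr: "(\<lambda>n. adj A (A (X (r n))) - s\<^sup>2 *\<^sub>R X (r n)) \<longlonglongrightarrow> 0"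
    using LIMSEQ_subseq_LIMSEQ[OF ev r] by (simp add: comp_def)
  define \<phi> where "\<phi> = (1 / s\<^sup>2) *\<^sub>R (adj A l - 0)"
  have "(\<lambda>n. (1 / s\<^sup>2) *\<^sub>R (adj A (A (X (r n))) - (adj A (A (X (r n))) - s\<^sup>2 *\<^sub>R X (r n)))) \<longlonglongrightarrow> \<phi>"
    unfolding \<phi>_def by (intro tendsto_intros bounded_linear.tendsto[OF blA'] l evr)
  then have \<phi>: "(\<lambda>n. X (r n)) \<longlonglongrightarrow> \<phi>"
    using s by simp
  have "\<phi> \<in> M"
    using closed_sequentially[OF closed _ \<phi>] X(1) by blast
  moreover have norm: "norm \<phi> = 1"
    using tendsto_norm[OF \<phi>] X(2) by (simp add: LIMSEQ_const_iff)
  moreover have s_eq: "norm (A \<phi>) = s"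
  proof (rule LIMSEQ_unique)
    show "(\<lambda>n. norm (A (X (r n)))) \<longlonglongrightarrow> norm (A \<phi>)"
      by (intro tendsto_norm bounded_linear.tendsto[OF blA] \<phi>)
    show "(\<lambda>n. norm (A (X (r n)))) \<longlonglongrightarrow> s"
      using LIMSEQ_subseq_LIMSEQ[OF lim r] by (simp add: comp_def)
  qed
  moreover have "adj A (A \<phi>) - s\<^sup>2 *\<^sub>R \<phi> = 0"
  proof (rule LIMSEQ_unique)
    show "(\<lambda>n. adj A (A (X (r n))) - s\<^sup>2 *\<^sub>R X (r n)) \<longlonglongrightarrow> adj A (A \<phi>) - s\<^sup>2 *\<^sub>R \<phi>"
      by (intro tendsto_intros bounded_linear.tendsto[OF blA'] bounded_linear.tendsto[OF blA] \<phi>)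
  qed (rule evr)
  ultimately show ?thesis
    using le by (intro bexI[of _ \<phi>]) simp_all
qed

definition ortho_compl :: "'a::complex_inner set \<Rightarrow> 'a set"
  where "ortho_compl X = {x. \<forall>e\<in>X. cinner e x = 0}"

lemma closed_ortho_compl: "closed (ortho_compl X)"
proof -
  have "closed {x. cinner e x = 0}" for e :: 'a
    using closed_vimage[OF closed_singleton linear_continuous_on[OF bounded_linear_cinner_right[of e]], of 0]
    by (simp add: vimage_def)
  then have "closed (\<Inter>e\<in>X. {x. cinner e x = 0})"
    by (intro closed_INT) blast
  moreover have "(\<Inter>e\<in>X. {x. cinner e x = 0}) = ortho_compl X"
    by (auto simp: ortho_compl_def)
  ultimately show ?thesis
    by simp
qed

lemma ortho_compl_invariant:
  fixes A :: "'a::chilbert_space \<Rightarrow> 'a"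
  assumes A: "bounded_clinear A" and X: "\<forall>e\<in>X. \<exists>r. adj A (A e) = r *\<^sub>R e"
    and x: "x \<in> ortho_compl X"
  shows "adj A (A x) \<in> ortho_compl X"
  unfolding ortho_compl_def
proof (intro CollectI ballI)
  fix e assume "e \<in> X"
  then obtain r where "adj A (A e) = r *\<^sub>R e"
    using X by blast
  then have "cinner e (adj A (A x)) = r *\<^sub>R cinner e x"
    by (metis A cinner_adj_left cinner_adj_right cinner_scaleR_left)
  then show "cinner e (adj A (A x)) = 0"
    using x \<open>e \<in> X\<close> by (simp add: ortho_compl_def)
qed

text \<open>The value \<open>0\<close> signals that \<open>A\<close> vanishes on the orthogonal complement of \<open>X\<close>; adjoining it to
  \<open>X\<close> does not change this complement, so from then on all further choices are \<open>0\<close> as well.\<close>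

definition next_eigvec :: "('a::complex_inner \<Rightarrow> 'a) \<Rightarrow> 'a set \<Rightarrow> 'a"
  where "next_eigvec A X = (if \<forall>x\<in>ortho_compl X. A x = 0 then 0 else
    SOME \<phi>. \<phi> \<in> ortho_compl X \<and> norm \<phi> = 1 \<and> adj A (A \<phi>) = (norm (A \<phi>))\<^sup>2 *\<^sub>R \<phi> \<and>
      (\<forall>x\<in>ortho_compl X. norm (A x) \<le> norm (A \<phi>) * norm x))"

primrec greedy_eigvecs :: "('a::complex_inner \<Rightarrow> 'a) \<Rightarrow> nat \<Rightarrow> 'a set"
  where
    "greedy_eigvecs A 0 = {}"
  | "greedy_eigvecs A (Suc k) = insert (next_eigvec A (greedy_eigvecs A k)) (greedy_eigvecs A k)"

lemma next_eigvec:
  fixes A :: "'a::chilbert_space \<Rightarrow> 'a"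
  assumes A: "hilbert_schmidt A" and X: "\<forall>e\<in>X. \<exists>r. adj A (A e) = r *\<^sub>R e"
  shows "next_eigvec A X \<in> ortho_compl X"
    and "next_eigvec A X \<noteq> 0 \<Longrightarrow> norm (next_eigvec A X) = 1"
    and "adj A (A (next_eigvec A X)) = (norm (A (next_eigvec A X)))\<^sup>2 *\<^sub>R next_eigvec A X"
    and "x \<in> ortho_compl X \<Longrightarrow> norm (A x) \<le> norm (A (next_eigvec A X)) * norm x"
proof -
  note bA = hilbert_schmidt_bounded_clinear[OF A]
  let ?\<phi> = "next_eigvec A X"
  have "?\<phi> \<in> ortho_compl X \<and> (?\<phi> \<noteq> 0 \<longrightarrow> norm ?\<phi> = 1) \<and> adj A (A ?\<phi>) = (norm (A ?\<phi>))\<^sup>2 *\<^sub>R ?\<phi> \<and>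
      (\<forall>x\<in>ortho_compl X. norm (A x) \<le> norm (A ?\<phi>) * norm x)"
  proof (cases "\<forall>x\<in>ortho_compl X. A x = 0")
    case True
    then have "?\<phi> = 0"
      by (simp add: next_eigvec_def)
    then show ?thesis
      using True bounded_clinear_linear(3)[OF bA] bounded_clinear_linear(3)[OF bounded_clinear_adj[OF bA]]
      by (simp add: ortho_compl_def)
  next
    case False
    have "\<exists>\<phi>\<in>ortho_compl X. norm \<phi> = 1 \<and> adj A (A \<phi>) = (norm (A \<phi>))\<^sup>2 *\<^sub>R \<phi> \<and>
        (\<forall>x\<in>ortho_compl X. norm (A x) \<le> norm (A \<phi>) * norm x)"
    proof (rule maximal_eigenvector[OF A closed_ortho_compl])
      show "r *\<^sub>R x \<in> ortho_compl X" if "x \<in> ortho_compl X" for x r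
        using that by (simp add: ortho_compl_def cinner_scaleR_right)
      show "adj A (A x) \<in> ortho_compl X" if "x \<in> ortho_compl X" for x
        by (rule ortho_compl_invariant[OF bA X that])
    qed (use False in blast)
    then have "\<exists>\<phi>. \<phi> \<in> ortho_compl X \<and> norm \<phi> = 1 \<and> adj A (A \<phi>) = (norm (A \<phi>))\<^sup>2 *\<^sub>R \<phi> \<and>
        (\<forall>x\<in>ortho_compl X. norm (A x) \<le> norm (A \<phi>) * norm x)"
      unfolding Bex_def .
    from someI_ex[OF this] show ?thesis
      unfolding next_eigvec_def if_not_P[OF False] by blast
  qed
  then show "?\<phi> \<in> ortho_compl X" "?\<phi> \<noteq> 0 \<Longrightarrow> norm ?\<phi> = 1" "adj A (A ?\<phi>) = (norm (A ?\<phi>))\<^sup>2 *\<^sub>R ?\<phi>"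
    "x \<in> ortho_compl X \<Longrightarrow> norm (A x) \<le> norm (A ?\<phi>) * norm x"
    by blast+
qed

lemma greedy_eigvecs_eigen:
  fixes A :: "'a::chilbert_space \<Rightarrow> 'a"
  assumes A: "hilbert_schmidt A"
  shows "\<forall>e\<in>greedy_eigvecs A k. \<exists>r. adj A (A e) = r *\<^sub>R e"
proof (induction k)
  case (Suc k)
  then show ?case
    using next_eigvec(3)[OF A Suc.IH] by auto
qed simp

lemma greedy_eigvecs_eq_image:
  "greedy_eigvecs A k = (\<lambda>j. next_eigvec A (greedy_eigvecs A (j - 1))) ` {1..k}"
proof (induction k)
  case (Suc k)
  have "{1..Suc k} = insert (Suc k) {1..k}"
    by auto
  then show ?case
    using Suc by simp
qed simp

lemma next_eigvec_greedy_zero: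
  fixes A :: "'a::chilbert_space \<Rightarrow> 'a"
  assumes A: "hilbert_schmidt A" and zero: "next_eigvec A (greedy_eigvecs A i) = 0" and le: "i \<le> j"
  shows "next_eigvec A (greedy_eigvecs A j) = 0"
  using le
proof (induction j rule: dec_induct)
  case (step j)
  then have "ortho_compl (greedy_eigvecs A (Suc j)) = ortho_compl (greedy_eigvecs A j)"
    by (simp add: ortho_compl_def)
  then show ?case
    using step.IH by (simp only: next_eigvec_def)
qed (rule zero)

lemma down_closed_nat_cases:
  fixes J :: "nat set"
  assumes "\<And>i j. j \<in> J \<Longrightarrow> 1 \<le> i \<Longrightarrow> i \<le> j \<Longrightarrow> i \<in> J" and "0 \<notin> J"
  shows "J = {1..} \<or> (\<exists>N. J = {1..N})"
proof (cases "J = {1..}")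
  case False
  then obtain m where m: "1 \<le> m" "m \<notin> J"
    using assms(2) by (auto simp: set_eq_iff) (metis Suc_leI le0 nat_less_le)
  define N where "N = (LEAST m. 1 \<le> m \<and> m \<notin> J) - 1"
  have least: "1 \<le> (LEAST m. 1 \<le> m \<and> m \<notin> J) \<and> (LEAST m. 1 \<le> m \<and> m \<notin> J) \<notin> J"
    by (rule LeastI[of _ m]) (use m in blast)
  have "i \<in> J \<longleftrightarrow> i \<in> {1..N}" for i
  proof
    assume "i \<in> J"
    then have "\<not> (LEAST m. 1 \<le> m \<and> m \<notin> J) \<le> i"
      using assms(1) least by blast
    then show "i \<in> {1..N}"
      using \<open>i \<in> J\<close> assms(2) by (cases i) (auto simp: N_def)
  next
    assume "i \<in> {1..N}"
    then have "1 \<le> i" "i < (LEAST m. 1 \<le> m \<and> m \<notin> J)"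
      using least by (auto simp: N_def)
    then show "i \<in> J"
      using not_less_Least by blast
  qed
  then show ?thesis
    by blast
qed simp

text \<open>
  The eigenvectors are chosen greedily, each maximizing \<open>\<parallel>A x\<parallel>\<close> on the orthogonal complement of its
  predecessors, so the eigenvalues come out sorted. Once the first \<open>k\<close> eigenvectors are among those projected away, what remains of \<open>A\<^sup>* A\<close> has norm at most
  \<open>\<parallel>A\<^sup>*\<parallel> \<sigma>\<^sub>k\<^sub>+\<^sub>1\<close>, because \<open>\<sigma>\<^sub>k\<^sub>+\<^sub>1\<close> bounds \<open>A\<close> on the orthogonal complement; and \<open>\<Sum>\<sigma>\<^sub>j\<^sup>2\<close> is part of the
  Hilbert-Schmidt sum of \<open>A\<close>, so \<open>\<sigma>\<^sub>j \<rightarrow> 0\<close>.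
\<close>

theorem hilbert_schmidt_spectral_rep:
  fixes A :: "'a::chilbert_space \<Rightarrow> 'a"
  assumes A: "hilbert_schmidt A"
  shows "\<exists>J \<sigma> \<phi>. spectral_rep (adj A \<circ> A) J \<sigma> \<phi> \<and>
    ((\<lambda>F. onorm (\<lambda>x. (adj A \<circ> A) x - (\<Sum>j\<in>F. (\<sigma> j)\<^sup>2 *\<^sub>R rank_one (\<phi> j) (\<phi> j) x))) \<longlongrightarrow> 0)
      (finite_subsets_at_top J)"
proof -
  note bA = hilbert_schmidt_bounded_clinear[OF A]
  define \<phi> where "\<phi> j = next_eigvec A (greedy_eigvecs A (j - 1))" for j
  define \<sigma> where "\<sigma> j = norm (A (\<phi> j))" for j
  define J where "J = {j. 1 \<le> j \<and> \<phi> j \<noteq> 0}"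
  note next_props = next_eigvec[OF A greedy_eigvecs_eigen[OF A]]
  have image: "greedy_eigvecs A k = \<phi> ` {1..k}" for k
    using greedy_eigvecs_eq_image[of A k] by (simp add: \<phi>_def[abs_def])
  have norm: "norm (\<phi> j) = 1" if "j \<in> J" for j
    using next_props(2) that by (simp add: J_def \<phi>_def)
  have eigen: "adj A (A (\<phi> j)) = (\<sigma> j)\<^sup>2 *\<^sub>R \<phi> j" for j
    using next_props(3) by (simp add: \<phi>_def \<sigma>_def)
  have bound: "norm (A x) \<le> \<sigma> (Suc k) * norm x" if "\<And>i. i \<in> {1..k} \<Longrightarrow> cinner (\<phi> i) x = 0" for k x
  proof -
    have "x \<in> ortho_compl (greedy_eigvecs A k)"
      using that by (auto simp: image ortho_compl_def)
    from next_props(4)[OF this] show ?thesis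
      by (simp add: \<phi>_def \<sigma>_def)
  qed
  have ortho: "cinner (\<phi> i) (\<phi> j) = 0" if "1 \<le> i" "i < j" for i j
  proof -
    have "\<phi> j \<in> ortho_compl (greedy_eigvecs A (j - 1))"
      unfolding \<phi>_def by (rule next_props(1))
    moreover have "i \<in> {1..j - 1}"
      using that by auto
    ultimately show ?thesis
      by (simp add: image ortho_compl_def)
  qed
  have J_down: "i \<in> J" if "j \<in> J" "1 \<le> i" "i \<le> j" for i j
    using next_eigvec_greedy_zero[OF A _ diff_le_mono[OF that(3)], of 1] that by (auto simp: J_def \<phi>_def)
  then have J_cases: "J = {1..} \<or> (\<exists>N. J = {1..N})"
    by (rule down_closed_nat_cases) (simp_all add: J_def)
  have J_ge_1: "1 \<le> j" if "j \<in> J" for j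
    using that by (simp add: J_def)
  have orthonormal: "orthonormal_family \<phi> J"
    unfolding orthonormal_family_def
  proof (intro ballI)
    fix i j assume ij: "i \<in> J" "j \<in> J"
    consider "i = j" | "i < j" | "j < i" by linarith
    then show "cinner (\<phi> i) (\<phi> j) = (if i = j then 1 else 0)"
    proof cases
      case 1
      then show ?thesis
        using norm[OF ij(1)] by (simp add: cinner_self)
    next
      case 2
      then show ?thesis
        using ortho J_ge_1 ij by simp
    next
      case 3
      then show ?thesis
        using ortho[of j i] J_ge_1 ij by (simp add: cinner_eq_0_commute[of "\<phi> i"])
    qed
  qed
  have mono: "(\<sigma> j)\<^sup>2 \<le> (\<sigma> i)\<^sup>2" if "i \<in> J" "j \<in> J" "i \<le> j" for i j
  proof -
    have "norm (A (\<phi> j)) \<le> \<sigma> (Suc (i - 1)) * norm (\<phi> j)"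
      using ortho that by (intro bound) auto
    then have "\<sigma> j \<le> \<sigma> i"
      using norm[OF that(2)] J_ge_1[OF that(1)] by (simp add: \<sigma>_def[of j])
    then show ?thesis
      by (intro power_mono) (simp_all add: \<sigma>_def)
  qed
  have \<sigma>_tendsto: "(\<lambda>k. \<sigma> (Suc k)) \<longlonglongrightarrow> 0"
  proof -
    obtain B where B: "\<phi> ` J \<subseteq> B" "is_onb B"
      by (rule orthonormal_set_extends_to_onb[OF orthonormal_family_image(2)[OF orthonormal]])
    have "(\<lambda>e. (norm (A e))\<^sup>2) summable_on \<phi> ` J"
      using has_sum_imp_summable[OF hs_norm_has_sum[OF A B(2)]] B(1) by (rule summable_on_subset_banach)
    then have "(\<lambda>j. (\<sigma> j)\<^sup>2) summable_on J"
      by (subst (asm) summable_on_reindex[OF orthonormal_family_image(1)[OF orthonormal]])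
        (simp add: comp_def \<sigma>_def)
    moreover have "(\<lambda>j. (\<sigma> j)\<^sup>2) summable_on J \<longleftrightarrow> (\<lambda>j. (\<sigma> j)\<^sup>2) summable_on range Suc"
    proof (rule summable_on_cong_neutral)
      show "(\<sigma> j)\<^sup>2 = 0" if "j \<in> range Suc - J" for j
        using that by (auto simp: J_def \<sigma>_def bounded_clinear_linear[OF bA])
      show "(\<sigma> j)\<^sup>2 = 0" if "j \<in> J - range Suc" for j
        using that J_ge_1[of j] by (cases j) auto
    qed simp
    ultimately have "(\<lambda>k. (\<sigma> (Suc k))\<^sup>2) summable_on UNIV"
      by (simp add: summable_on_reindex comp_def)
    then have "(\<lambda>k. (\<sigma> (Suc k))\<^sup>2) \<longlonglongrightarrow> 0"
      by (intro summable_LIMSEQ_zero summable_on_imp_summable)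
    then show ?thesis
      using tendsto_real_sqrt[of "\<lambda>k. (\<sigma> (Suc k))\<^sup>2" 0] by (simp add: \<sigma>_def)
  qed
  define E where "E F x = (adj A \<circ> A) x - (\<Sum>j\<in>F. (\<sigma> j)\<^sup>2 *\<^sub>R rank_one (\<phi> j) (\<phi> j) x)" for F x
  define K where "K = onorm (adj A)"
  have K: "0 \<le> K"
    unfolding K_def
    by (rule onorm_pos_le[OF bounded_clinear_bounded_linear[OF bounded_clinear_adj[OF bA]]])
  have E_le: "norm (E F x) \<le> (K * \<sigma> (Suc k)) * norm x"
    if F: "finite F" "F \<subseteq> J" "J \<inter> {1..k} \<subseteq> F" for F k x
  proof -
    let ?P = "orth_proj (\<phi> ` F)"
    have on: "orthonormal_family \<phi> F"
      by (rule orthonormal_family_subset[OF orthonormal F(2)])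
    note img = orthonormal_family_image[OF on]
    have P: "?P x = (\<Sum>j\<in>F. rank_one (\<phi> j) (\<phi> j) x)"
      by (simp add: orth_proj_def sum.reindex[OF img(1)])
    have S: "bounded_clinear (adj A \<circ> A)"
      by (rule bounded_clinear_compose[OF bounded_clinear_adj[OF bA] bA])
    have "(adj A \<circ> A) (rank_one (\<phi> j) (\<phi> j) x) = (\<sigma> j)\<^sup>2 *\<^sub>R rank_one (\<phi> j) (\<phi> j) x" for j
      using eigen[of j] unfolding rank_one_def bounded_clinear_scaleC[OF S]
      by (simp add: scaleC_scaleR_commute)
    then have "E F x = (adj A \<circ> A) (x - ?P x)"
      unfolding E_def P bounded_clinear_linear[OF S] by simp
    then have "norm (E F x) \<le> K * norm (A (x - ?P x))"
      using bounded_clinear_norm_le[OF bounded_clinear_adj[OF bA]] by (simp add: K_def)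
    also have "norm (A (x - ?P x)) \<le> \<sigma> (Suc k) * norm (x - ?P x)"
    proof (rule bound)
      fix i assume "i \<in> {1..k}"
      then consider "\<phi> i = 0" | "i \<in> F"
        using F(3) by (auto simp: J_def)
      then show "cinner (\<phi> i) (x - ?P x) = 0"
        by cases (simp_all add: cinner_diff_right cinner_orth_proj[OF img(2) finite_imageI[OF F(1)] order_refl])
    qed
    also have "\<dots> \<le> \<sigma> (Suc k) * norm x"
      using norm_diff_orth_proj_le[OF img(2) finite_imageI[OF F(1)]]
      by (intro mult_left_mono) (simp_all add: \<sigma>_def)
    finally show ?thesis
      using K by (simp add: mult_left_mono mult.assoc)
  qed
  have onorm_tendsto: "((\<lambda>F. onorm (E F)) \<longlongrightarrow> 0) (finite_subsets_at_top J)"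
  proof (rule tendstoI)
    fix \<epsilon> :: real assume "\<epsilon> > 0"
    have "(\<lambda>k. K * \<sigma> (Suc k)) \<longlonglongrightarrow> 0"
      using tendsto_mult_left[OF \<sigma>_tendsto, of K] by simp
    then have "\<forall>\<^sub>F k in sequentially. K * \<sigma> (Suc k) < \<epsilon>"
      using \<open>\<epsilon> > 0\<close> by (rule order_tendstoD(2))
    then obtain k where k: "K * \<sigma> (Suc k) < \<epsilon>"
      by (auto simp: eventually_sequentially)
    have "dist (onorm (E F)) 0 < \<epsilon>" if F: "finite F" "J \<inter> {1..k} \<subseteq> F" "F \<subseteq> J" for F
    proof -
      have "bounded_linear (E F)"
        unfolding E_def[abs_def]
        using bounded_clinear_compose[OF bounded_clinear_adj[OF bA] bA] bounded_clinear_rank_one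
        by (intro bounded_linear_sub bounded_linear_sum bounded_linear_compose[OF bounded_linear_scaleR_right]
            bounded_clinear_bounded_linear)
      moreover have "onorm (E F) \<le> K * \<sigma> (Suc k)"
        by (rule onorm_bound) (use K E_le[OF F(1,3,2)] in \<open>simp_all add: \<sigma>_def\<close>)
      ultimately show ?thesis
        using k onorm_pos_le[of "E F"] by simp
    qed
    then show "\<forall>\<^sub>F F in finite_subsets_at_top J. dist (onorm (E F)) 0 < \<epsilon>"
      unfolding eventually_finite_subsets_at_top by (intro exI[of _ "J \<inter> {1..k}"]) simp
  qed
  have "((\<lambda>j. (\<sigma> j)\<^sup>2 *\<^sub>R rank_one (\<phi> j) (\<phi> j) x) has_sum (adj A \<circ> A) x) J" for x
  proof -
    have "((\<lambda>F. E F x) \<longlongrightarrow> 0) (finite_subsets_at_top J)"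
    proof (rule Lim_null_comparison)
      show "((\<lambda>F. onorm (E F) * norm x) \<longlongrightarrow> 0) (finite_subsets_at_top J)"
        using tendsto_mult_right[OF onorm_tendsto, of "norm x"] by simp
      show "\<forall>\<^sub>F F in finite_subsets_at_top J. norm (E F x) \<le> onorm (E F) * norm x"
      proof (intro eventually_finite_subsets_at_top_weakI onorm)
        show "bounded_linear (E F)" for F
          unfolding E_def[abs_def]
          using bounded_clinear_compose[OF bounded_clinear_adj[OF bA] bA] bounded_clinear_rank_one
          by (intro bounded_linear_sub bounded_linear_sum bounded_linear_compose[OF bounded_linear_scaleR_right]
              bounded_clinear_bounded_linear)
      qed
    qed
    from tendsto_diff[OF tendsto_const this, of "(adj A \<circ> A) x"] show ?thesis
      by (simp add: has_sum_def E_def)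
  qed
  moreover have "\<sigma> \<longlonglongrightarrow> 0"
    by (rule LIMSEQ_imp_Suc[OF \<sigma>_tendsto])
  ultimately have "spectral_rep (adj A \<circ> A) J \<sigma> \<phi>"
    using J_cases orthonormal mono unfolding spectral_rep_def by blast
  with onorm_tendsto show ?thesis
    unfolding E_def[abs_def] by blast
qed

lemma spectral_rep_apply:
  fixes G :: "'a::chilbert_space \<Rightarrow> 'a"
  assumes G: "spectral_rep G J \<sigma> \<phi>"
  shows "j \<in> J \<Longrightarrow> G (\<phi> j) = (\<sigma> j)\<^sup>2 *\<^sub>R \<phi> j"
    and "(\<And>j. j \<in> J \<Longrightarrow> cinner (\<phi> j) x = 0) \<Longrightarrow> G x = 0"
proof -
  have sum: "((\<lambda>j. (\<sigma> j)\<^sup>2 *\<^sub>R rank_one (\<phi> j) (\<phi> j) x) has_sum G x) J" for x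
    using G by (simp add: spectral_rep_def)
  have on: "cinner (\<phi> i) (\<phi> j) = (if i = j then 1 else 0)" if "i \<in> J" "j \<in> J" for i j
    using G that by (simp add: spectral_rep_def orthonormal_family_def)
  show "G (\<phi> j) = (\<sigma> j)\<^sup>2 *\<^sub>R \<phi> j" if "j \<in> J"
    by (rule has_sum_unique[OF sum], rule has_sum_finite_neutralI[where B = "{j}"])
      (use that in \<open>simp_all add: rank_one_def on\<close>)
  show "G x = 0" if "\<And>j. j \<in> J \<Longrightarrow> cinner (\<phi> j) x = 0"
    by (rule has_sum_unique[OF sum], rule has_sum_0) (simp add: rank_one_def that)
qed

lemma spectral_rep_eigenbasis:
  fixes G :: "'a::chilbert_space \<Rightarrow> 'a"
  assumes G: "spectral_rep G J \<sigma> \<phi>"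
  obtains B where "is_onb B" "\<phi> ` J \<subseteq> B" "\<And>e. e \<in> B - \<phi> ` J \<Longrightarrow> G e = 0"
proof -
  have on: "orthonormal_family \<phi> J"
    using G by (simp add: spectral_rep_def)
  obtain B where B: "\<phi> ` J \<subseteq> B" "is_onb B"
    by (rule orthonormal_set_extends_to_onb[OF orthonormal_family_image(2)[OF on]])
  have "G e = 0" if e: "e \<in> B - \<phi> ` J" for e
  proof (rule spectral_rep_apply(2)[OF G])
    fix j assume "j \<in> J"
    then have "\<phi> j \<in> B" "\<phi> j \<noteq> e"
      using B(1) e by auto
    then show "cinner (\<phi> j) e = 0"
      using onb_orthonormal[OF B(2)] e by (simp add: orthonormal_family_def)
  qed
  with B show ?thesis
    by (intro that)
qed

section \<open>The variational principle\<close>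

text \<open>
  Maximizing \<open>\<Sum>\<^sub>j s\<^sub>j a\<^sub>j\<close> subject to \<open>0 \<le> a\<^sub>j \<le> 1\<close> and \<open>\<Sum>\<^sub>j a\<^sub>j \<le> |I|\<close>, where \<open>t\<close> separates the values of \<open>s\<close>
  on \<open>I\<close> from those off \<open>I\<close>: the deficit against \<open>\<Sum>\<^sub>I s\<^sub>j\<close> is \<open>t (|I| - \<Sum>\<^sub>j a\<^sub>j)\<close> plus the sum of the
  terms below, all of which are nonnegative.
\<close>

lemma weighted_sum_deficit:
  fixes s a :: "'i \<Rightarrow> real"
  assumes I: "finite I" "I \<subseteq> J" and a: "(a has_sum \<alpha>) J" and v: "((\<lambda>j. s j * a j) has_sum v) J"
  shows "((\<lambda>j. if j \<in> I then (s j - t) * (1 - a j) else (t - s j) * a j) has_sum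
    (sum s I - v - t * (real (card I) - \<alpha>))) J"
proof -
  have "((\<lambda>j. if j \<in> I then s j - t else 0) has_sum (\<Sum>j\<in>I. s j - t)) J"
    by (rule has_sum_finite_neutralI[OF I]) simp_all
  from has_sum_add[OF has_sum_add[OF this has_sum_cmult_right[OF a, of t]] has_sum_cmult_right[OF v, of "- 1"]]
  have "((\<lambda>j. (if j \<in> I then s j - t else 0) + t * a j + - 1 * (s j * a j)) has_sum
      (\<Sum>j\<in>I. s j - t) + t * \<alpha> + - 1 * v) J" .
  moreover have "(\<lambda>j. (if j \<in> I then s j - t else 0) + t * a j + - 1 * (s j * a j)) =
      (\<lambda>j. if j \<in> I then (s j - t) * (1 - a j) else (t - s j) * a j)"
    by (auto simp: fun_eq_iff algebra_simps)
  moreover have "(\<Sum>j\<in>I. s j - t) + t * \<alpha> + - 1 * v = sum s I - v - t * (real (card I) - \<alpha>)"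
    by (simp add: sum_subtractf algebra_simps)
  ultimately show ?thesis
    by (simp only:)
qed

lemma weighted_sum_le:
  fixes s a :: "'i \<Rightarrow> real"
  assumes I: "finite I" "I \<subseteq> J" and a: "(a has_sum \<alpha>) J" and v: "((\<lambda>j. s j * a j) has_sum v) J"
    and a01: "\<And>j. j \<in> J \<Longrightarrow> 0 \<le> a j \<and> a j \<le> 1" and \<alpha>: "\<alpha> \<le> real (card I)"
    and t: "0 \<le> t" "\<And>j. j \<in> I \<Longrightarrow> t \<le> s j" "\<And>j. j \<in> J - I \<Longrightarrow> s j \<le> t"
  shows "v \<le> sum s I"
proof -
  have "0 \<le> sum s I - v - t * (real (card I) - \<alpha>)"
    by (rule has_sum_nonneg[OF weighted_sum_deficit[OF I a v]]) (use a01 t(2,3) I(2) in auto)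
  moreover have "0 \<le> t * (real (card I) - \<alpha>)"
    using t(1) \<alpha> by simp
  ultimately show ?thesis
    by simp
qed

text \<open>In the case of equality every term of the deficit vanishes. As \<open>t\<close> lies strictly above the values
  of \<open>s\<close> off \<open>I\<close>, this kills \<open>a\<close> there, and then the full mass \<open>|I|\<close> has to sit on \<open>I\<close>.\<close>

lemma weighted_sum_eq_imp:
  fixes s a :: "'i \<Rightarrow> real"
  assumes I: "finite I" "I \<subseteq> J" and a: "(a has_sum \<alpha>) J" and v: "((\<lambda>j. s j * a j) has_sum sum s I) J"
    and a01: "\<And>j. j \<in> J \<Longrightarrow> 0 \<le> a j \<and> a j \<le> 1" and \<alpha>: "\<alpha> \<le> real (card I)"
    and t: "0 < t" "\<And>j. j \<in> I \<Longrightarrow> t \<le> s j" "\<And>j. j \<in> J - I \<Longrightarrow> s j < t"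
    and i: "i \<in> I"
  shows "a i = 1"
proof -
  let ?d = "\<lambda>j. if j \<in> I then (s j - t) * (1 - a j) else (t - s j) * a j"
  have d: "(?d has_sum - (t * (real (card I) - \<alpha>))) J"
    using weighted_sum_deficit[OF I a v, of t] by simp
  have nonneg: "0 \<le> ?d j" if "j \<in> J" for j
    using a01[OF that] t(2)[of j] t(3)[of j] that by (cases "j \<in> I") simp_all
  have "0 \<le> - (t * (real (card I) - \<alpha>))"
    by (rule has_sum_nonneg[OF d nonneg])
  then have "\<alpha> = real (card I)"
    using t(1) \<alpha> by (simp add: mult_le_0_iff)
  with d have d0: "(?d has_sum 0) J"
    by simp
  have "a j = 0" if "j \<in> J - I" for j
    using nonneg_has_sum_le_0D[OF d0 _ nonneg, of j] t(3)[OF that] that by auto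
  then have "(a has_sum sum a I) J"
    by (intro has_sum_finite_neutralI[OF I]) simp_all
  with a have "sum a I = real (card I)"
    using \<open>\<alpha> = real (card I)\<close> has_sum_unique by blast
  then have "(\<Sum>j\<in>I. 1 - a j) = 0"
    by (simp add: sum_subtractf)
  moreover have "\<forall>j\<in>I. 0 \<le> 1 - a j"
    using a01 I(2) by auto
  ultimately show ?thesis
    using i sum_nonneg_eq_0_iff[OF I(1), of "\<lambda>j. 1 - a j"] by auto
qed

lemma hs_projectionD:
  fixes Q :: "'a::chilbert_space \<Rightarrow> 'a"
  assumes "hs_projection n Q"
  shows "hilbert_schmidt Q" "bounded_clinear Q" "Q = adj Q" "Q = Q \<circ> Q" "(hs_norm Q)\<^sup>2 = real n"
    and "cinner x (Q x) = complex_of_real ((norm (Q x))\<^sup>2)" "norm (Q x) \<le> norm x"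
proof -
  show props: "hilbert_schmidt Q" "Q = adj Q" "Q = Q \<circ> Q" "(hs_norm Q)\<^sup>2 = real n"
    using assms unfolding hs_projection_def by blast+
  show bQ: "bounded_clinear Q"
    by (rule hilbert_schmidt_bounded_clinear[OF props(1)])
  have "cinner (Q x) (Q x) = cinner x (Q (Q x))"
    using cinner_adj_left[OF bQ, of x "Q x"] props(2) by simp
  moreover have "Q (Q x) = Q x"
    using props(3) by (metis comp_apply)
  ultimately show eq: "cinner x (Q x) = complex_of_real ((norm (Q x))\<^sup>2)"
    by (simp only: cinner_self)
  have "(norm (Q x))\<^sup>2 \<le> norm x * norm (Q x)"
    using cmod_cinner_le[of x "Q x"] unfolding eq by (simp add: norm_power)
  then show "norm (Q x) \<le> norm x"
    by (cases "norm (Q x) = 0") (auto simp: power2_eq_square mult_le_cancel_right)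
qed

text \<open>In an orthonormal basis that extends \<open>F\<close>, the vectors of \<open>F\<close> already exhaust \<open>\<Sum>\<parallel>Q e\<parallel>\<^sup>2 = n\<close>.\<close>

lemma hs_projection_eq_orth_proj:
  fixes Q :: "'a::chilbert_space \<Rightarrow> 'a"
  assumes Q: "hs_projection (card F) Q" and F: "orthonormal_set F" "finite F"
    and norm1: "\<And>e. e \<in> F \<Longrightarrow> norm (Q e) = 1"
  shows "Q = orth_proj F"
proof -
  obtain B where B: "F \<subseteq> B" "is_onb B"
    by (rule orthonormal_set_extends_to_onb[OF F(1)])
  note Qp = hs_projectionD[OF Q]
  have sum: "((\<lambda>e. (norm (Q e))\<^sup>2) has_sum real (card F)) B"
    using hs_norm_has_sum[OF Qp(1) B(2)] Qp(5) by simp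
  show ?thesis
  proof (rule bounded_clinear_eq_on_onb[OF Qp(2) bounded_clinear_orth_proj B(2)])
    fix e assume e: "e \<in> B"
    show "Q e = orth_proj F e"
    proof (cases "e \<in> F")
      case True
      have "cinner (Q e) e = 1"
        using Qp(6)[of e] norm1[OF True] by (subst cinner_commute) simp
      moreover have "cinner (Q e) (Q e) = 1" "cinner e (Q e) = 1" "cinner e e = 1"
        using Qp(6)[of e] norm1[OF True] orthonormal_family_norm[OF F(1) True]
        by (simp_all add: cinner_self)
      ultimately have "cinner (Q e - e) (Q e - e) = 0"
        by (simp only: cinner_diff_left cinner_diff_right) simp
      then have "Q e = e"
        by simp
      then show ?thesis
        using True by (simp add: orth_proj_fixes[OF onb_orthonormal[OF B(2)] F(2) B(1) e])
    next
      case False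
      have "(\<Sum>e\<in>insert e F. (norm (Q e))\<^sup>2) \<le> real (card F)"
        by (rule finite_sum_le_has_sum[OF sum]) (use F(2) e B(1) in auto)
      then have "Q e = 0"
        using False F(2) norm1 by simp
      then show ?thesis
        using False by (simp add: orth_proj_fixes[OF onb_orthonormal[OF B(2)] F(2) B(1) e])
    qed
  qed
qed

text \<open>The trace formula \<open>\<parallel>Q T\<parallel>\<^sub>H\<^sub>S\<^sup>2 = tr (Q G)\<close>, evaluated in a basis of eigenvectors of \<open>G = T T\<^sup>*\<close>.\<close>

lemma hs_norm_compose_spectral:
  fixes T Q :: "'a::chilbert_space \<Rightarrow> 'a"
  assumes T: "hilbert_schmidt T" and Q: "hs_projection n Q" and G: "spectral_rep (T \<circ> adj T) J \<sigma> \<phi>"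
  shows "((\<lambda>j. (\<sigma> j)\<^sup>2 * (norm (Q (\<phi> j)))\<^sup>2) has_sum (hs_norm (Q \<circ> T))\<^sup>2) J"
proof -
  note Qp = hs_projectionD[OF Q]
  let ?G = "T \<circ> adj T"
  have on: "orthonormal_family \<phi> J"
    using G by (simp add: spectral_rep_def)
  obtain B where B: "is_onb B" "\<phi> ` J \<subseteq> B" "\<And>e. e \<in> B - \<phi> ` J \<Longrightarrow> ?G e = 0"
    using spectral_rep_eigenbasis[OF G] by blast
  have "((\<lambda>e. cinner e (Q (?G e))) has_sum complex_of_real ((hs_norm (Q \<circ> T))\<^sup>2)) B"
    using hs_norm_projection_compose_has_sum[OF T Qp(2-4) B(1)] by simp
  also have "?this \<longleftrightarrow>
      ((\<lambda>e. cinner e (Q (?G e))) has_sum complex_of_real ((hs_norm (Q \<circ> T))\<^sup>2)) (\<phi> ` J)"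
  proof (rule has_sum_cong_neutral)
    show "cinner e (Q (?G e)) = 0" if "e \<in> B - \<phi> ` J" for e
      unfolding B(3)[OF that] bounded_clinear_linear(3)[OF Qp(2)] by simp
  qed (use B(2) in auto)
  also have "\<dots> \<longleftrightarrow> ((\<lambda>j. cinner (\<phi> j) (Q (?G (\<phi> j)))) has_sum complex_of_real ((hs_norm (Q \<circ> T))\<^sup>2)) J"
    by (subst has_sum_reindex[OF orthonormal_family_image(1)[OF on]]) (simp only: comp_def)
  also have "\<dots> \<longleftrightarrow> ((\<lambda>j. complex_of_real ((\<sigma> j)\<^sup>2 * (norm (Q (\<phi> j)))\<^sup>2)) has_sum
      complex_of_real ((hs_norm (Q \<circ> T))\<^sup>2)) J"
  proof (rule has_sum_cong)
    fix j assume "j \<in> J"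
    have "cinner (\<phi> j) (Q (?G (\<phi> j))) = (\<sigma> j)\<^sup>2 *\<^sub>R cinner (\<phi> j) (Q (\<phi> j))"
      unfolding spectral_rep_apply(1)[OF G \<open>j \<in> J\<close>] bounded_clinear_linear(4)[OF Qp(2)]
      by (rule cinner_scaleR_right)
    then show "cinner (\<phi> j) (Q (?G (\<phi> j))) = complex_of_real ((\<sigma> j)\<^sup>2 * (norm (Q (\<phi> j)))\<^sup>2)"
      by (simp only: Qp(6) scaleR_conv_of_real of_real_mult)
  qed
  finally show ?thesis
    by (simp only: has_sum_of_real_iff)
qed

lemma hs_projection_orthonormal_family_sum:
  fixes Q :: "'a::chilbert_space \<Rightarrow> 'a"
  assumes Q: "hs_projection n Q" and on: "orthonormal_family \<phi> J"
  obtains \<alpha> where "((\<lambda>j. (norm (Q (\<phi> j)))\<^sup>2) has_sum \<alpha>) J" "\<alpha> \<le> real n"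
proof -
  note Qp = hs_projectionD[OF Q]
  obtain B where B: "\<phi> ` J \<subseteq> B" "is_onb B"
    by (rule orthonormal_set_extends_to_onb[OF orthonormal_family_image(2)[OF on]])
  have sum: "((\<lambda>e. (norm (Q e))\<^sup>2) has_sum real n) B"
    using hs_norm_has_sum[OF Qp(1) B(2)] Qp(5) by simp
  then obtain \<alpha> where \<alpha>: "((\<lambda>e. (norm (Q e))\<^sup>2) has_sum \<alpha>) (\<phi> ` J)"
    using summable_on_subset_banach[OF has_sum_imp_summable[OF sum] B(1)] by (auto simp: summable_on_def)
  have "\<alpha> \<le> real n"
    by (rule has_sum_mono'[OF \<alpha> sum B(1)]) simp
  moreover have "((\<lambda>j. (norm (Q (\<phi> j)))\<^sup>2) has_sum \<alpha>) J"
    using \<alpha> by (subst (asm) has_sum_reindex[OF orthonormal_family_image(1)[OF on]]) (simp only: comp_def)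
  ultimately show ?thesis
    by (rule that[rotated])
qed

context
  fixes T :: "'a::chilbert_space \<Rightarrow> 'a" and J :: "nat set" and \<sigma> :: "nat \<Rightarrow> real" and \<phi> :: "nat \<Rightarrow> 'a" and n :: nat
  assumes T: "hilbert_schmidt T" and G: "spectral_rep (T \<circ> adj T) J \<sigma> \<phi>" and n: "{1..n} \<subseteq> J"
begin

lemma leading_orthonormal:
  "orthonormal_family \<phi> J" "inj_on \<phi> {1..n}" "orthonormal_set (\<phi> ` {1..n})" "card (\<phi> ` {1..n}) = n"
proof -
  show on: "orthonormal_family \<phi> J"
    using G by (simp add: spectral_rep_def)
  show inj: "inj_on \<phi> {1..n}" and "orthonormal_set (\<phi> ` {1..n})"
    using orthonormal_family_image[OF orthonormal_family_subset[OF on n]] .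
  show "card (\<phi> ` {1..n}) = n"
    using card_image[OF inj] by simp
qed

lemma leading_hs_projection: "hs_projection n (orth_proj (\<phi> ` {1..n}))"
  using hs_projection_orth_proj[OF leading_orthonormal(3)] leading_orthonormal(4) by simp

lemma hs_norm_leading_projection:
  "(hs_norm (orth_proj (\<phi> ` {1..n}) \<circ> T))\<^sup>2 = (\<Sum>j=1..n. (\<sigma> j)\<^sup>2)"
proof (rule has_sum_unique[OF hs_norm_compose_spectral[OF T leading_hs_projection G]])
  have val: "orth_proj (\<phi> ` {1..n}) (\<phi> j) = (if j \<in> {1..n} then \<phi> j else 0)" if "j \<in> J" for j
  proof -
    have "\<phi> j \<in> \<phi> ` {1..n} \<longleftrightarrow> j \<in> {1..n}"
      by (rule inj_on_image_mem_iff[OF orthonormal_family_image(1)[OF leading_orthonormal(1)] that n])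
    moreover have "orth_proj (\<phi> ` {1..n}) (\<phi> j) = (if \<phi> j \<in> \<phi> ` {1..n} then \<phi> j else 0)"
      using n that
      by (intro orth_proj_fixes[OF orthonormal_family_image(2)[OF leading_orthonormal(1)]]) auto
    ultimately show ?thesis
      by simp
  qed
  show "((\<lambda>j. (\<sigma> j)\<^sup>2 * (norm (orth_proj (\<phi> ` {1..n}) (\<phi> j)))\<^sup>2) has_sum (\<Sum>j=1..n. (\<sigma> j)\<^sup>2)) J"
  proof (rule has_sum_finite_neutralI[OF _ n])
    show "(\<Sum>j=1..n. (\<sigma> j)\<^sup>2) = (\<Sum>j=1..n. (\<sigma> j)\<^sup>2 * (norm (orth_proj (\<phi> ` {1..n}) (\<phi> j)))\<^sup>2)"
    proof (rule sum.cong[OF refl])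
      fix j assume "j \<in> {1..n}"
      with n have "j \<in> J"
        by blast
      then show "(\<sigma> j)\<^sup>2 = (\<sigma> j)\<^sup>2 * (norm (orth_proj (\<phi> ` {1..n}) (\<phi> j)))\<^sup>2"
        using \<open>j \<in> {1..n}\<close> orthonormal_family_norm[OF leading_orthonormal(1)]
        by (simp only: val) simp
    qed
    show "(\<sigma> j)\<^sup>2 * (norm (orth_proj (\<phi> ` {1..n}) (\<phi> j)))\<^sup>2 = 0" if "j \<in> J - {1..n}" for j
      unfolding val[OF DiffD1[OF that]] using that by auto
  qed simp
qed

lemma spectral_index_down_closed: "j \<in> J \<Longrightarrow> 1 \<le> i \<Longrightarrow> i \<le> j \<Longrightarrow> i \<in> J"
  using G by (auto simp: spectral_rep_def)

lemma spectral_index_pos: "j \<in> J \<Longrightarrow> 1 \<le> j"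
  using G by (auto simp: spectral_rep_def)

lemma spectral_mono: "i \<in> J \<Longrightarrow> j \<in> J \<Longrightarrow> i \<le> j \<Longrightarrow> (\<sigma> j)\<^sup>2 \<le> (\<sigma> i)\<^sup>2"
  using G unfolding spectral_rep_def by blast

text \<open>The weights are \<open>a\<^sub>j = \<parallel>Q \<phi>\<^sub>j\<parallel>\<^sup>2\<close>: at most \<open>1\<close> since \<open>Q\<close> is a projection, and of total at most
  \<open>\<parallel>Q\<parallel>\<^sub>H\<^sub>S\<^sup>2 = n\<close> since the \<open>\<phi>\<^sub>j\<close> are part of an orthonormal basis.\<close>

lemma hs_norm_projection_le:
  assumes Q: "hs_projection n Q"
  shows "(hs_norm (Q \<circ> T))\<^sup>2 \<le> (\<Sum>j=1..n. (\<sigma> j)\<^sup>2)"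
proof -
  obtain \<alpha> where \<alpha>: "((\<lambda>j. (norm (Q (\<phi> j)))\<^sup>2) has_sum \<alpha>) J" "\<alpha> \<le> real n"
    by (rule hs_projection_orthonormal_family_sum[OF Q leading_orthonormal(1)])
  show ?thesis
  \<comment> \<open>The threshold is \<open>\<sigma>\<^sub>n\<^sup>2\<close>; for \<open>n = 0\<close> it has to dominate the whole spectrum, so it is \<open>\<sigma>\<^sub>1\<^sup>2\<close>.\<close>
  proof (rule weighted_sum_le[OF _ n \<alpha>(1) hs_norm_compose_spectral[OF T Q G]])
    show "0 \<le> (norm (Q (\<phi> j)))\<^sup>2 \<and> (norm (Q (\<phi> j)))\<^sup>2 \<le> 1" if "j \<in> J" for j
      using hs_projectionD(7)[OF Q, of "\<phi> j"] orthonormal_family_norm[OF leading_orthonormal(1) that]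
      by (simp add: power_le_one)
    show "(\<sigma> (max n 1))\<^sup>2 \<le> (\<sigma> j)\<^sup>2" if "j \<in> {1..n}" for j
      using that n by (intro spectral_mono) auto
    show "(\<sigma> j)\<^sup>2 \<le> (\<sigma> (max n 1))\<^sup>2" if "j \<in> J - {1..n}" for j
    proof (rule spectral_mono)
      show "max n 1 \<le> j"
        using that spectral_index_pos[of j] by auto
      with that show "max n 1 \<in> J"
        by (auto intro: spectral_index_down_closed[OF DiffD1[OF that]])
    qed (use that in simp)
  qed (use \<alpha>(2) in simp_all)
qed

lemma hs_norm_projection_eq_imp:
  assumes Q: "hs_projection n Q" and eq: "(hs_norm (Q \<circ> T))\<^sup>2 = (\<Sum>j=1..n. (\<sigma> j)\<^sup>2)"
    and gap: "1 \<le> n" "\<sigma> n \<noteq> 0" "Suc n \<in> J \<Longrightarrow> (\<sigma> (Suc n))\<^sup>2 < (\<sigma> n)\<^sup>2"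
  shows "Q = orth_proj (\<phi> ` {1..n})"
proof (rule hs_projection_eq_orth_proj[OF _ leading_orthonormal(3)])
  obtain \<alpha> where \<alpha>: "((\<lambda>j. (norm (Q (\<phi> j)))\<^sup>2) has_sum \<alpha>) J" "\<alpha> \<le> real n"
    by (rule hs_projection_orthonormal_family_sum[OF Q leading_orthonormal(1)])
  have v: "((\<lambda>j. (\<sigma> j)\<^sup>2 * (norm (Q (\<phi> j)))\<^sup>2) has_sum (\<Sum>j=1..n. (\<sigma> j)\<^sup>2)) J"
    using hs_norm_compose_spectral[OF T Q G] unfolding eq .
  have "(norm (Q (\<phi> i)))\<^sup>2 = 1" if "i \<in> {1..n}" for i
  proof (rule weighted_sum_eq_imp[OF _ n \<alpha>(1) v])
    show "0 \<le> (norm (Q (\<phi> j)))\<^sup>2 \<and> (norm (Q (\<phi> j)))\<^sup>2 \<le> 1" if "j \<in> J" for j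
      using hs_projectionD(7)[OF Q, of "\<phi> j"] orthonormal_family_norm[OF leading_orthonormal(1) that]
      by (simp add: power_le_one)
    show "(\<sigma> n)\<^sup>2 \<le> (\<sigma> j)\<^sup>2" if "j \<in> {1..n}" for j
      using that n by (intro spectral_mono) auto
    show "(\<sigma> j)\<^sup>2 < (\<sigma> n)\<^sup>2" if "j \<in> J - {1..n}" for j
    proof -
      have "Suc n \<le> j"
        using that spectral_index_pos[of j] by auto
      then have "Suc n \<in> J"
        by (intro spectral_index_down_closed[OF DiffD1[OF that]]) simp_all
      moreover have "(\<sigma> j)\<^sup>2 \<le> (\<sigma> (Suc n))\<^sup>2"
        using that \<open>Suc n \<le> j\<close> \<open>Suc n \<in> J\<close> by (intro spectral_mono) auto
      ultimately show ?thesis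
        using gap(3) by simp
    qed
  qed (use \<alpha>(2) gap(2) that in simp_all)
  then show "norm (Q e) = 1" if "e \<in> \<phi> ` {1..n}" for e
    using that by (auto simp: abs_square_eq_1)
qed (use Q leading_orthonormal(4) in simp_all)

lemma leading_projection_arg_max:
  "is_arg_max (\<lambda>Q. (hs_norm (Q \<circ> T))\<^sup>2) (hs_projection n) (orth_proj (\<phi> ` {1..n}))"
  unfolding is_arg_max_def hs_norm_leading_projection
  using leading_hs_projection hs_norm_projection_le by (auto simp: not_less)

lemma leading_projection_unique_arg_max:
  assumes "1 \<le> n" "\<sigma> n \<noteq> 0" "Suc n \<in> J \<Longrightarrow> (\<sigma> (Suc n))\<^sup>2 < (\<sigma> n)\<^sup>2"
  shows "{P. is_arg_max (\<lambda>Q. (hs_norm (Q \<circ> T))\<^sup>2) (hs_projection n) P} = {orth_proj (\<phi> ` {1..n})}"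
proof -
  have "P = orth_proj (\<phi> ` {1..n})"
    if P: "is_arg_max (\<lambda>Q. (hs_norm (Q \<circ> T))\<^sup>2) (hs_projection n) P" for P
  proof (rule hs_norm_projection_eq_imp)
    show feasible: "hs_projection n P"
      using P by (simp add: is_arg_max_def)
    have "\<not> (hs_norm (P \<circ> T))\<^sup>2 < (\<Sum>j=1..n. (\<sigma> j)\<^sup>2)"
      using P leading_hs_projection unfolding is_arg_max_def hs_norm_leading_projection[symmetric] by blast
    with hs_norm_projection_le[OF feasible] show "(hs_norm (P \<circ> T))\<^sup>2 = (\<Sum>j=1..n. (\<sigma> j)\<^sup>2)"
      by simp
  qed (fact assms)+
  with leading_projection_arg_max show ?thesis
    by blast
qed

lemma leading_projection_eq:
  "(\<lambda>x. \<Sum>j=1..n. rank_one (\<phi> j) (\<phi> j) x) = orth_proj (\<phi> ` {1..n})"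
  by (simp only: fun_eq_iff orth_proj_def sum.reindex[OF leading_orthonormal(2)] comp_apply) simp

end

theorem theorem2p11:
  fixes T :: "'a::chilbert_space \<Rightarrow> 'a"
  assumes "bounded_clinear T"
  shows
    \<comment> \<open>(a)\<close>
    "(hilbert_schmidt T \<longrightarrow>
        (\<forall>J \<sigma> \<phi> n. spectral_rep (T \<circ> adj T) J \<sigma> \<phi> \<and> {1..n} \<subseteq> J \<longrightarrow>
           is_arg_max (\<lambda>Q. (hs_norm (Q \<circ> T))\<^sup>2) (hs_projection n)
             (\<lambda>x. \<Sum>j=1..n. rank_one (\<phi> j) (\<phi> j) x) \<and>
           (1 \<le> n \<and> \<sigma> n \<noteq> 0 \<and> (Suc n \<in> J \<longrightarrow> (\<sigma> (Suc n))\<^sup>2 < (\<sigma> n)\<^sup>2) \<longrightarrow>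
             {P. is_arg_max (\<lambda>Q. (hs_norm (Q \<circ> T))\<^sup>2) (hs_projection n) P} =
             {\<lambda>x. \<Sum>j=1..n. rank_one (\<phi> j) (\<phi> j) x})) \<and>
        (\<forall>n Q. hs_projection n Q \<longrightarrow>
           complex_of_real ((hs_norm (Q \<circ> T))\<^sup>2) = op_trace (Q \<circ> (T \<circ> adj T)))) \<and>
    \<comment> \<open>(b)\<close>
     (hilbert_schmidt T \<longleftrightarrow> trace_class (adj T \<circ> T)) \<and>
     (hilbert_schmidt T \<longrightarrow>
        (\<exists>B. is_onb B \<and> (\<forall>e\<in>B. \<exists>\<mu>. (adj T \<circ> T) e = \<mu> *\<^sub>C e)) \<and>
        (\<exists>J \<sigma> \<phi>. spectral_rep (T \<circ> adj T) J \<sigma> \<phi> \<and>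
           ((\<lambda>F. onorm (\<lambda>x. (T \<circ> adj T) x - (\<Sum>j\<in>F. (\<sigma> j)\<^sup>2 *\<^sub>R rank_one (\<phi> j) (\<phi> j) x))) \<longlongrightarrow> 0)
             (finite_subsets_at_top J)))"
proof (intro conjI impI allI)
  fix J \<sigma> \<phi> n
  assume T: "hilbert_schmidt T" and "spectral_rep (T \<circ> adj T) J \<sigma> \<phi> \<and> {1..n} \<subseteq> J"
  then have G: "spectral_rep (T \<circ> adj T) J \<sigma> \<phi>" and n: "{1..n} \<subseteq> J"
    by blast+
  note eq = leading_projection_eq[OF T G n]
  show "is_arg_max (\<lambda>Q. (hs_norm (Q \<circ> T))\<^sup>2) (hs_projection n) (\<lambda>x. \<Sum>j=1..n. rank_one (\<phi> j) (\<phi> j) x)"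
    unfolding eq by (rule leading_projection_arg_max[OF T G n])
  assume "1 \<le> n \<and> \<sigma> n \<noteq> 0 \<and> (Suc n \<in> J \<longrightarrow> (\<sigma> (Suc n))\<^sup>2 < (\<sigma> n)\<^sup>2)"
  then show "{P. is_arg_max (\<lambda>Q. (hs_norm (Q \<circ> T))\<^sup>2) (hs_projection n) P} =
      {\<lambda>x. \<Sum>j=1..n. rank_one (\<phi> j) (\<phi> j) x}"
    unfolding eq by (intro leading_projection_unique_arg_max[OF T G n]) blast+
next
  fix n and Q :: "'a \<Rightarrow> 'a"
  assume T: "hilbert_schmidt T" and Q: "hs_projection n Q"
  show "complex_of_real ((hs_norm (Q \<circ> T))\<^sup>2) = op_trace (Q \<circ> (T \<circ> adj T))"
    by (rule op_trace_eqI[symmetric], rule hs_norm_projection_compose_has_sum[OF T hs_projectionD(2-4)[OF Q]])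
next
  show "hilbert_schmidt T \<longleftrightarrow> trace_class (adj T \<circ> T)"
    by (rule hilbert_schmidt_iff_trace_class[OF assms])
next
  assume T: "hilbert_schmidt T"
  obtain J \<sigma> \<phi> where G: "spectral_rep (adj T \<circ> T) J \<sigma> \<phi>"
    using hilbert_schmidt_spectral_rep[OF T] by blast
  obtain B where B: "is_onb B" "\<phi> ` J \<subseteq> B" "\<And>e. e \<in> B - \<phi> ` J \<Longrightarrow> (adj T \<circ> T) e = 0"
    using spectral_rep_eigenbasis[OF G] by blast
  have "\<exists>\<mu>. (adj T \<circ> T) e = \<mu> *\<^sub>C e" if "e \<in> B" for e
  proof (cases "e \<in> \<phi> ` J")
    case True
    then obtain j where "j \<in> J" "e = \<phi> j"
      by blast
    then show ?thesis
      using spectral_rep_apply(1)[OF G] by (metis scaleC_of_real)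
  next
    case False
    then have "(adj T \<circ> T) e = 0 *\<^sub>C e"
      using B(3) that by simp
    then show ?thesis ..
  qed
  with B(1) show "\<exists>B. is_onb B \<and> (\<forall>e\<in>B. \<exists>\<mu>. (adj T \<circ> T) e = \<mu> *\<^sub>C e)"
    by blast
next
  assume T: "hilbert_schmidt T"
  from hilbert_schmidt_spectral_rep[OF hilbert_schmidt_adj[OF T]]
  show "\<exists>J \<sigma> \<phi>. spectral_rep (T \<circ> adj T) J \<sigma> \<phi> \<and>
      ((\<lambda>F. onorm (\<lambda>x. (T \<circ> adj T) x - (\<Sum>j\<in>F. (\<sigma> j)\<^sup>2 *\<^sub>R rank_one (\<phi> j) (\<phi> j) x))) \<longlongrightarrow> 0)
        (finite_subsets_at_top J)"
    unfolding adj_adj[OF assms] .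
qed

end
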